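(* Let $\mathsf{A}$ be a pseudo-tensor category with commutor over a field $\mathbf{k}$ and assume that $\mathcal{R}(\mathsf{A})^M=0$ for some $M\in\mathbb{N}$. Then $\mathcal{I}\mapsto\mathrm{Ob}(\mathcal{I})$ yields a bijection between the set of prime tensor ideals and the set of prime thick tensor ideals in $\mathsf{A}$, with inverse $\mathbf{I}\mapsto\mathbf{I}^{\max}$. Hence a tensor ideal $\mathcal{I}$ is prime if and only if it is semiprimitive and $\mathrm{Ob}(\mathcal{I})$ is prime. If $\mathbf{k}$ is algebraically closed, every prime tensor ideal in $\mathsf{A}$ is faithfully prime.
   Context: A pseudo-tensor category over $\mathbf{k}$ is an essentially small $\mathbf{k}$-linear monoidal category $(\mathsf{A},\otimes,\mathbf{1})$ that is additive, idempotent complete, has finite-dimensional morphism spaces, satisfies $\mathbf{k}\xrightarrow{\sim}\mathrm{End}(\mathbf{1})$, and in which every object has a left and a right dual. A commutor is a bi-natural isomorphism $X\otimes Y\xrightarrow{\sim}Y\otimes X$ (no further axioms). $\mathcal{R}(\mathsf{A})$ is the (Jacobson) radical of the $\mathbf{k}$-linear category $\mathsf{A}$: $\mathcal{R}(X,Y)=\{f\in\mathsf{A}(X,Y)\mid \mathrm{id}_X-g\circ f\text{ is invertible for all }g\in\mathsf{A}(Y,X)\}$; the power $\mathcal{R}^M$ consists of sums of compositions of $M$ morphisms in $\mathcal{R}$. A thick tensor ideal is a collection $\mathbf{I}$ of objects, closed under isomorphism, such that $X\in\mathbf{I}$ implies $Y\otimes X,X\otimes Y\in\mathbf{I}$ for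 all $Y$, and $X_1\oplus X_2\in\mathbf{I}$ iff $X_1,X_2\in\mathbf{I}$; it is prime if $\mathbf{1}\notin\mathbf{I}$ and $X\otimes Y\in\mathbf{I}$ implies $X\in\mathbf{I}$ or $Y\in\mathbf{I}$. A tensor ideal $\mathcal{I}$ is a system of subspaces $\mathcal{I}(X,Y)\subset\mathrm{Hom}(X,Y)$ closed under composition on either side with arbitrary morphisms and under $Z\otimes-$ and $-\otimes Z$ for all objects $Z$. It is prime if it is not the identity ideal (all morphisms) and $f\otimes g\in\mathcal{I}$ implies $f\in\mathcal{I}$ or $g\in\mathcal{I}$. It is faithfully prime if it is not the identity ideal and for all $X,Y,U,V$ the preimage of $\mathcal{I}(X\otimes U,Y\otimes V)$ under $\mathrm{Hom}(X,Y)\otimes_{\mathbf{k}}\mathrm{Hom}(U,V)\xrightarrow{\otimes}\mathrm{Hom}(X\otimes U,Y\otimes V)$ equals $\mathcal{I}(X,Y)\otimes_{\mathbf{k}}\mathrm{Hom}(U,V)+\mathrm{Hom}(X,Y)\otimes_{\mathbf{k}}\mathcal{I}(U,V)$. $\mathrm{Ob}(\mathcal{I})$ is the thick tensor ideal of objects $X$ with $\mathrm{id}_X\in\mathcal{I}$. For a thick tensor ideal $\mathbf{I}$, $\mathbf{I}^{\max}$ denotes the (existing, unique) largest tensor ideal $\mathcal{I}$ with $\mathrm{Ob}(\mathcal{I})=\mathbf{I}$; a tensor ideal is semiprimitive if it is of the form $\mathbf{I}^{\max}$ for some thick tensor ideal $\mathbf{I}$. *)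

theory Defs
  imports
    "HOL-Library.Poly_Mapping"
    "HOL-Computational_Algebra.Polynomial"
begin

section \<open>Pseudo-tensor categories\<close>

text \<open>
  The objects of a (small) linear category are the elements of the type \<^typ>\<open>'o\<close>. All morphism
  spaces are subspaces of one ambient vector space \<^typ>\<open>'m\<close> over the field \<^typ>\<open>'k\<close>, and
  composition is not indexed by objects. Every small linear category has this form up to
  isomorphism: take for \<^typ>\<open>'m\<close> the direct sum of all morphism spaces and extend composition
  (and tensor products of morphisms) bilinearly, with value 0 on incompatible pairs of summands.
  The laws are only required on the morphism spaces.
\<close>

record ('k, 'o, 'm) lin_cat =
  scl :: "'k \<Rightarrow> 'm \<Rightarrow> 'm"
  Hom :: "'o \<Rightarrow> 'o \<Rightarrow> 'm set"
  Id :: "'o \<Rightarrow> 'm"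
  Comp :: "'m \<Rightarrow> 'm \<Rightarrow> 'm" (infixl "\<cdot>\<index>" 70)

text \<open>
  \<open>X \<odot> Y\<close> is the tensor product of objects and \<open>f \<otimes> g\<close> that of morphisms. The associator has
  components \<open>(X \<odot> Y) \<odot> Z \<rightarrow> X \<odot> (Y \<odot> Z)\<close>.
\<close>

record ('k, 'o, 'm) mon_cat = "('k, 'o, 'm) lin_cat" +
  TensO :: "'o \<Rightarrow> 'o \<Rightarrow> 'o" (infixl "\<odot>\<index>" 75)
  TensM :: "'m \<Rightarrow> 'm \<Rightarrow> 'm" (infixl "\<otimes>\<index>" 75)
  Unit :: "'o" ("\<one>\<index>")
  Assoc :: "'o \<Rightarrow> 'o \<Rightarrow> 'o \<Rightarrow> 'm"
  LUnit :: "'o \<Rightarrow> 'm"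
  RUnit :: "'o \<Rightarrow> 'm"

definition inverse_mors :: "('k, 'o, 'm, 'z) lin_cat_scheme \<Rightarrow> 'o \<Rightarrow> 'o \<Rightarrow> 'm \<Rightarrow> 'm \<Rightarrow> bool" where
  "inverse_mors C X Y f g \<longleftrightarrow>
     f \<in> Hom C X Y \<and> g \<in> Hom C Y X \<and> g \<cdot>\<^bsub>C\<^esub> f = Id C X \<and> f \<cdot>\<^bsub>C\<^esub> g = Id C Y"

definition iso_mor :: "('k, 'o, 'm, 'z) lin_cat_scheme \<Rightarrow> 'o \<Rightarrow> 'o \<Rightarrow> 'm \<Rightarrow> bool" where
  "iso_mor C X Y f \<longleftrightarrow> (\<exists>g. inverse_mors C X Y f g)"

definition isomorphic_objs :: "('k, 'o, 'm, 'z) lin_cat_scheme \<Rightarrow> 'o \<Rightarrow> 'o \<Rightarrow> bool" where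
  "isomorphic_objs C X Y \<longleftrightarrow> (\<exists>f. iso_mor C X Y f)"

locale linear_category = vector_space "scl C"
  for C :: "('k::field, 'o, 'm::ab_group_add, 'z) lin_cat_scheme" (structure) +
  assumes subspace_Hom: "subspace (Hom C X Y)"
    and Id_in_Hom: "Id C X \<in> Hom C X X"
    and Comp_in_Hom: "\<lbrakk>f \<in> Hom C X Y; g \<in> Hom C Y Z\<rbrakk> \<Longrightarrow> g \<cdot> f \<in> Hom C X Z"
    and Comp_assoc:
      "\<lbrakk>f \<in> Hom C X Y; g \<in> Hom C Y Z; h \<in> Hom C Z W\<rbrakk> \<Longrightarrow> h \<cdot> (g \<cdot> f) = (h \<cdot> g) \<cdot> f"
    and Comp_Id_left: "f \<in> Hom C X Y \<Longrightarrow> Id C Y \<cdot> f = f"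
    and Comp_Id_right: "f \<in> Hom C X Y \<Longrightarrow> f \<cdot> Id C X = f"
    and Comp_add_left:
      "\<lbrakk>f \<in> Hom C X Y; g \<in> Hom C Y Z; g' \<in> Hom C Y Z\<rbrakk> \<Longrightarrow> (g + g') \<cdot> f = g \<cdot> f + g' \<cdot> f"
    and Comp_add_right:
      "\<lbrakk>f \<in> Hom C X Y; f' \<in> Hom C X Y; g \<in> Hom C Y Z\<rbrakk> \<Longrightarrow> g \<cdot> (f + f') = g \<cdot> f + g \<cdot> f'"
    and Comp_scl_left:
      "\<lbrakk>f \<in> Hom C X Y; g \<in> Hom C Y Z\<rbrakk> \<Longrightarrow> scl C c g \<cdot> f = scl C c (g \<cdot> f)"
    and Comp_scl_right:
      "\<lbrakk>f \<in> Hom C X Y; g \<in> Hom C Y Z\<rbrakk> \<Longrightarrow> g \<cdot> scl C c f = scl C c (g \<cdot> f)"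

definition is_zero_object :: "('k, 'o, 'm::zero, 'z) lin_cat_scheme \<Rightarrow> 'o \<Rightarrow> bool" where
  "is_zero_object C Z \<longleftrightarrow> (\<forall>X. Hom C Z X = {0} \<and> Hom C X Z = {0})"

definition is_direct_sum ::
  "('k, 'o, 'm::ab_group_add, 'z) lin_cat_scheme \<Rightarrow> 'o \<Rightarrow> 'o \<Rightarrow> 'o \<Rightarrow> bool" where
  "is_direct_sum C X X\<^sub>1 X\<^sub>2 \<longleftrightarrow>
     (\<exists>i\<^sub>1 \<in> Hom C X\<^sub>1 X. \<exists>i\<^sub>2 \<in> Hom C X\<^sub>2 X. \<exists>p\<^sub>1 \<in> Hom C X X\<^sub>1. \<exists>p\<^sub>2 \<in> Hom C X X\<^sub>2.
        p\<^sub>1 \<cdot>\<^bsub>C\<^esub> i\<^sub>1 = Id C X\<^sub>1 \<and> p\<^sub>2 \<cdot>\<^bsub>C\<^esub> i\<^sub>2 = Id C X\<^sub>2 \<and>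
        p\<^sub>2 \<cdot>\<^bsub>C\<^esub> i\<^sub>1 = 0 \<and> p\<^sub>1 \<cdot>\<^bsub>C\<^esub> i\<^sub>2 = 0 \<and>
        i\<^sub>1 \<cdot>\<^bsub>C\<^esub> p\<^sub>1 + i\<^sub>2 \<cdot>\<^bsub>C\<^esub> p\<^sub>2 = Id C X)"

locale linear_monoidal_category = linear_category C
  for C :: "('k::field, 'o, 'm::ab_group_add, 'z) mon_cat_scheme" (structure) +
  assumes TensM_in_Hom:
      "\<lbrakk>f \<in> Hom C X Y; g \<in> Hom C U V\<rbrakk> \<Longrightarrow> f \<otimes> g \<in> Hom C (X \<odot> U) (Y \<odot> V)"
    and TensM_Id: "Id C X \<otimes> Id C Y = Id C (X \<odot> Y)"
    and TensM_Comp: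
      "\<lbrakk>f \<in> Hom C X Y; f' \<in> Hom C Y Z; g \<in> Hom C U V; g' \<in> Hom C V W\<rbrakk>
        \<Longrightarrow> (f' \<cdot> f) \<otimes> (g' \<cdot> g) = (f' \<otimes> g') \<cdot> (f \<otimes> g)"
    and TensM_add_left:
      "\<lbrakk>f \<in> Hom C X Y; f' \<in> Hom C X Y; g \<in> Hom C U V\<rbrakk> \<Longrightarrow> (f + f') \<otimes> g = f \<otimes> g + f' \<otimes> g"
    and TensM_add_right:
      "\<lbrakk>f \<in> Hom C X Y; g \<in> Hom C U V; g' \<in> Hom C U V\<rbrakk> \<Longrightarrow> f \<otimes> (g + g') = f \<otimes> g + f \<otimes> g'"
    and TensM_scl_left:
      "\<lbrakk>f \<in> Hom C X Y; g \<in> Hom C U V\<rbrakk> \<Longrightarrow> scl C c f \<otimes> g = scl C c (f \<otimes> g)"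
    and TensM_scl_right:
      "\<lbrakk>f \<in> Hom C X Y; g \<in> Hom C U V\<rbrakk> \<Longrightarrow> f \<otimes> scl C c g = scl C c (f \<otimes> g)"
    and Assoc_iso: "iso_mor C ((X \<odot> Y) \<odot> Z) (X \<odot> (Y \<odot> Z)) (Assoc C X Y Z)"
    and Assoc_natural:
      "\<lbrakk>f \<in> Hom C X X'; g \<in> Hom C Y Y'; h \<in> Hom C Z Z'\<rbrakk>
        \<Longrightarrow> Assoc C X' Y' Z' \<cdot> ((f \<otimes> g) \<otimes> h) = (f \<otimes> (g \<otimes> h)) \<cdot> Assoc C X Y Z"
    and LUnit_iso: "iso_mor C (\<one> \<odot> X) X (LUnit C X)"
    and LUnit_natural: "f \<in> Hom C X Y \<Longrightarrow> LUnit C Y \<cdot> (Id C \<one> \<otimes> f) = f \<cdot> LUnit C X"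
    and RUnit_iso: "iso_mor C (X \<odot> \<one>) X (RUnit C X)"
    and RUnit_natural: "f \<in> Hom C X Y \<Longrightarrow> RUnit C Y \<cdot> (f \<otimes> Id C \<one>) = f \<cdot> RUnit C X"
    and pentagon:
      "Assoc C W X (Y \<odot> Z) \<cdot> Assoc C (W \<odot> X) Y Z
        = (Id C W \<otimes> Assoc C X Y Z) \<cdot> (Assoc C W (X \<odot> Y) Z \<cdot> (Assoc C W X Y \<otimes> Id C Z))"
    and triangle: "(Id C X \<otimes> LUnit C Y) \<cdot> Assoc C X \<one> Y = RUnit C X \<otimes> Id C Y"

text \<open>
  \<open>Y\<close> is a left dual of \<open>X\<close> (equivalently, \<open>X\<close> is a right dual of \<open>Y\<close>), with evaluation
  \<open>Y \<odot> X \<rightarrow> \<one>\<close> and coevaluation \<open>\<one> \<rightarrow> X \<odot> Y\<close>. The two equations are the usual zigzag identities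
  after composing with the unitors \<open>\<one> \<odot> X \<rightarrow> X\<close> and \<open>Y \<odot> \<one> \<rightarrow> Y\<close>; the morphism \<open>\<beta>\<close> is the inverse
  associator \<open>Y \<odot> (X \<odot> Y) \<rightarrow> (Y \<odot> X) \<odot> Y\<close>.
\<close>

definition is_left_dual :: "('k, 'o, 'm, 'z) mon_cat_scheme \<Rightarrow> 'o \<Rightarrow> 'o \<Rightarrow> bool" where
  "is_left_dual C Y X \<longleftrightarrow>
     (\<exists>ev \<in> Hom C (Y \<odot>\<^bsub>C\<^esub> X) \<one>\<^bsub>C\<^esub>. \<exists>coev \<in> Hom C \<one>\<^bsub>C\<^esub> (X \<odot>\<^bsub>C\<^esub> Y). \<exists>\<beta>.
        inverse_mors C ((Y \<odot>\<^bsub>C\<^esub> X) \<odot>\<^bsub>C\<^esub> Y) (Y \<odot>\<^bsub>C\<^esub> (X \<odot>\<^bsub>C\<^esub> Y)) (Assoc C Y X Y) \<beta> \<and>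
        RUnit C X \<cdot>\<^bsub>C\<^esub> ((Id C X \<otimes>\<^bsub>C\<^esub> ev) \<cdot>\<^bsub>C\<^esub> (Assoc C X Y X \<cdot>\<^bsub>C\<^esub> (coev \<otimes>\<^bsub>C\<^esub> Id C X)))
          = LUnit C X \<and>
        LUnit C Y \<cdot>\<^bsub>C\<^esub> ((ev \<otimes>\<^bsub>C\<^esub> Id C Y) \<cdot>\<^bsub>C\<^esub> (\<beta> \<cdot>\<^bsub>C\<^esub> (Id C Y \<otimes>\<^bsub>C\<^esub> coev)))
          = RUnit C Y)"

locale pseudo_tensor_category = linear_monoidal_category C
  for C :: "('k::field, 'o, 'm::ab_group_add, 'z) mon_cat_scheme" (structure) +
  assumes ex_zero_object: "\<exists>Z. is_zero_object C Z"
    and ex_direct_sum: "\<exists>X. is_direct_sum C X X\<^sub>1 X\<^sub>2"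
    and idempotent_complete:
      "\<lbrakk>e \<in> Hom C X X; e \<cdot> e = e\<rbrakk>
        \<Longrightarrow> \<exists>Y. \<exists>r \<in> Hom C X Y. \<exists>s \<in> Hom C Y X. r \<cdot> s = Id C Y \<and> s \<cdot> r = e"
    and finite_dim_Hom: "\<exists>B. finite B \<and> span B = Hom C X Y"
    and End_Unit: "bij_betw (\<lambda>c. scl C c (Id C \<one>)) UNIV (Hom C \<one> \<one>)"
    and ex_left_dual: "\<exists>Y. is_left_dual C Y X"
    and ex_right_dual: "\<exists>Y. is_left_dual C X Y"

definition commutor :: "('k, 'o, 'm, 'z) mon_cat_scheme \<Rightarrow> ('o \<Rightarrow> 'o \<Rightarrow> 'm) \<Rightarrow> bool" where
  "commutor C \<gamma> \<longleftrightarrow>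
     (\<forall>X Y. iso_mor C (X \<odot>\<^bsub>C\<^esub> Y) (Y \<odot>\<^bsub>C\<^esub> X) (\<gamma> X Y)) \<and>
     (\<forall>X X' Y Y'. \<forall>f \<in> Hom C X X'. \<forall>g \<in> Hom C Y Y'.
        \<gamma> X' Y' \<cdot>\<^bsub>C\<^esub> (f \<otimes>\<^bsub>C\<^esub> g) = (g \<otimes>\<^bsub>C\<^esub> f) \<cdot>\<^bsub>C\<^esub> \<gamma> X Y)"


section \<open>The radical and its powers\<close>

definition radical :: "('k, 'o, 'm::ab_group_add, 'z) lin_cat_scheme \<Rightarrow> 'o \<Rightarrow> 'o \<Rightarrow> 'm set" where
  "radical C X Y =
     {f \<in> Hom C X Y. \<forall>g \<in> Hom C Y X. iso_mor C X X (Id C X - g \<cdot>\<^bsub>C\<^esub> f)}"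

inductive radical_comp ::
  "('k, 'o, 'm::ab_group_add, 'z) lin_cat_scheme \<Rightarrow> nat \<Rightarrow> 'o \<Rightarrow> 'o \<Rightarrow> 'm \<Rightarrow> bool" for C where
  Nil: "radical_comp C 0 X X (Id C X)"
| Cons: "\<lbrakk>radical_comp C n X Y f; g \<in> radical C Y Z\<rbrakk> \<Longrightarrow> radical_comp C (Suc n) X Z (g \<cdot>\<^bsub>C\<^esub> f)"

definition radical_power ::
  "('k, 'o, 'm::ab_group_add, 'z) lin_cat_scheme \<Rightarrow> nat \<Rightarrow> 'o \<Rightarrow> 'o \<Rightarrow> 'm set" where
  "radical_power C M X Y = {sum_list fs | fs. \<forall>f \<in> set fs. radical_comp C M X Y f}"


section \<open>Thick tensor ideals and tensor ideals\<close>

text \<open>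
  The condition on direct sums includes the empty direct sum: a thick tensor ideal contains the
  zero objects. This only excludes the empty collection, which is never of the form \<open>Ob \<I>\<close>.
\<close>

definition thick_tensor_ideal ::
  "('k, 'o, 'm::ab_group_add, 'z) mon_cat_scheme \<Rightarrow> 'o set \<Rightarrow> bool" where
  "thick_tensor_ideal C J \<longleftrightarrow>
     (\<forall>X Y. X \<in> J \<and> isomorphic_objs C X Y \<longrightarrow> Y \<in> J) \<and>
     (\<forall>X \<in> J. \<forall>Y. Y \<odot>\<^bsub>C\<^esub> X \<in> J \<and> X \<odot>\<^bsub>C\<^esub> Y \<in> J) \<and>
     (\<forall>Z. is_zero_object C Z \<longrightarrow> Z \<in> J) \<and>
     (\<forall>X X\<^sub>1 X\<^sub>2. is_direct_sum C X X\<^sub>1 X\<^sub>2 \<longrightarrow> (X \<in> J \<longleftrightarrow> X\<^sub>1 \<in> J \<and> X\<^sub>2 \<in> J))"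

definition prime_thick_tensor_ideal ::
  "('k, 'o, 'm::ab_group_add, 'z) mon_cat_scheme \<Rightarrow> 'o set \<Rightarrow> bool" where
  "prime_thick_tensor_ideal C J \<longleftrightarrow>
     thick_tensor_ideal C J \<and> \<one>\<^bsub>C\<^esub> \<notin> J \<and> (\<forall>X Y. X \<odot>\<^bsub>C\<^esub> Y \<in> J \<longrightarrow> X \<in> J \<or> Y \<in> J)"

definition tensor_ideal ::
  "('k::field, 'o, 'm::ab_group_add, 'z) mon_cat_scheme \<Rightarrow> ('o \<Rightarrow> 'o \<Rightarrow> 'm set) \<Rightarrow> bool" where
  "tensor_ideal C I \<longleftrightarrow>
     (\<forall>X Y. module.subspace (scl C) (I X Y) \<and> I X Y \<subseteq> Hom C X Y) \<and>
     (\<forall>X Y Z. \<forall>f \<in> I X Y. \<forall>g \<in> Hom C Y Z. g \<cdot>\<^bsub>C\<^esub> f \<in> I X Z) \<and>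
     (\<forall>X Y Z. \<forall>f \<in> Hom C X Y. \<forall>g \<in> I Y Z. g \<cdot>\<^bsub>C\<^esub> f \<in> I X Z) \<and>
     (\<forall>X Y Z. \<forall>f \<in> I X Y.
        Id C Z \<otimes>\<^bsub>C\<^esub> f \<in> I (Z \<odot>\<^bsub>C\<^esub> X) (Z \<odot>\<^bsub>C\<^esub> Y) \<and> f \<otimes>\<^bsub>C\<^esub> Id C Z \<in> I (X \<odot>\<^bsub>C\<^esub> Z) (Y \<odot>\<^bsub>C\<^esub> Z))"

definition prime_tensor_ideal ::
  "('k::field, 'o, 'm::ab_group_add, 'z) mon_cat_scheme \<Rightarrow> ('o \<Rightarrow> 'o \<Rightarrow> 'm set) \<Rightarrow> bool" where
  "prime_tensor_ideal C I \<longleftrightarrow>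
     tensor_ideal C I \<and> I \<noteq> Hom C \<and>
     (\<forall>X Y U V. \<forall>f \<in> Hom C X Y. \<forall>g \<in> Hom C U V.
        f \<otimes>\<^bsub>C\<^esub> g \<in> I (X \<odot>\<^bsub>C\<^esub> U) (Y \<odot>\<^bsub>C\<^esub> V) \<longrightarrow> f \<in> I X Y \<or> g \<in> I U V)"

definition Ob :: "('k, 'o, 'm, 'z) lin_cat_scheme \<Rightarrow> ('o \<Rightarrow> 'o \<Rightarrow> 'm set) \<Rightarrow> 'o set" where
  "Ob C I = {X. Id C X \<in> I X X}"

text \<open>Tensor ideals are ordered by pointwise inclusion, the order of \<^typ>\<open>'o \<Rightarrow> 'o \<Rightarrow> 'm set\<close>.\<close>

definition max_ideal ::
  "('k::field, 'o, 'm::ab_group_add, 'z) mon_cat_scheme \<Rightarrow> 'o set \<Rightarrow> 'o \<Rightarrow> 'o \<Rightarrow> 'm set" where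
  "max_ideal C J = (GREATEST I. tensor_ideal C I \<and> Ob C I = J)"

definition semiprimitive ::
  "('k::field, 'o, 'm::ab_group_add, 'z) mon_cat_scheme \<Rightarrow> ('o \<Rightarrow> 'o \<Rightarrow> 'm set) \<Rightarrow> bool" where
  "semiprimitive C I \<longleftrightarrow> (\<exists>J. thick_tensor_ideal C J \<and> I = max_ideal C J)"


section \<open>Tensor products of vector spaces and faithfully prime tensor ideals\<close>

text \<open>
  For subspaces \<open>V\<close>, \<open>W\<close> of an ambient space, \<open>V \<otimes>\<^sub>k W\<close> is constructed as the quotient of the free
  vector space on \<open>V \<times> W\<close> by the bilinearity relations; its elements are the equivalence classes.
\<close>

definition free_scl :: "'k::field \<Rightarrow> ('x \<Rightarrow>\<^sub>0 'k) \<Rightarrow> ('x \<Rightarrow>\<^sub>0 'k)" where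
  "free_scl c t = Poly_Mapping.map ((*) c) t"

definition free_space :: "'x set \<Rightarrow> ('x \<Rightarrow>\<^sub>0 'k::field) set" where
  "free_space S = {t. Poly_Mapping.keys t \<subseteq> S}"

definition bilinear_relators ::
  "('k::field \<Rightarrow> 'm::ab_group_add \<Rightarrow> 'm) \<Rightarrow> 'm set \<Rightarrow> 'm set \<Rightarrow> ('m \<times> 'm \<Rightarrow>\<^sub>0 'k) set" where
  "bilinear_relators s V W =
     (let e = (\<lambda>v w. Poly_Mapping.single (v, w) 1) in
       {e (v + v') w - e v w - e v' w | v v' w. v \<in> V \<and> v' \<in> V \<and> w \<in> W} \<union>
       {e v (w + w') - e v w - e v w' | v w w'. v \<in> V \<and> w \<in> W \<and> w' \<in> W} \<union>
       {e (s c v) w - free_scl c (e v w) | c v w. v \<in> V \<and> w \<in> W} \<union>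
       {e v (s c w) - free_scl c (e v w) | c v w. v \<in> V \<and> w \<in> W})"

definition tensor_rel ::
  "('k::field \<Rightarrow> 'm::ab_group_add \<Rightarrow> 'm) \<Rightarrow> 'm set \<Rightarrow> 'm set \<Rightarrow> (('m \<times> 'm \<Rightarrow>\<^sub>0 'k) \<times> ('m \<times> 'm \<Rightarrow>\<^sub>0 'k)) set" where
  "tensor_rel s V W =
     {(t, t'). t \<in> free_space (V \<times> W) \<and> t' \<in> free_space (V \<times> W) \<and>
        t - t' \<in> module.span free_scl (bilinear_relators s V W)}"

definition tensor_space ::
  "('k::field \<Rightarrow> 'm::ab_group_add \<Rightarrow> 'm) \<Rightarrow> 'm set \<Rightarrow> 'm set \<Rightarrow> ('m \<times> 'm \<Rightarrow>\<^sub>0 'k) set set" where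
  "tensor_space s V W = free_space (V \<times> W) // tensor_rel s V W"

text \<open>The subspace \<open>V' \<otimes>\<^sub>k W + V \<otimes>\<^sub>k W'\<close> of \<open>V \<otimes>\<^sub>k W\<close>, for subspaces \<open>V'\<close> of \<open>V\<close> and \<open>W'\<close> of \<open>W\<close>.\<close>

definition tensor_subspace_sum ::
  "('k::field \<Rightarrow> 'm::ab_group_add \<Rightarrow> 'm) \<Rightarrow> 'm set \<Rightarrow> 'm set \<Rightarrow> 'm set \<Rightarrow> 'm set
    \<Rightarrow> ('m \<times> 'm \<Rightarrow>\<^sub>0 'k) set set" where
  "tensor_subspace_sum s V' V W' W =
     {tensor_rel s V W `` {t + t'} | t t'. t \<in> free_space (V' \<times> W) \<and> t' \<in> free_space (V \<times> W')}"

text \<open>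
  The linear map \<open>Hom(X,Y) \<otimes>\<^sub>k Hom(U,V) \<rightarrow> Hom(X \<odot> U, Y \<odot> V)\<close> induced by the tensor product of
  morphisms: first on representatives, then on classes, on which it is constant.
\<close>

definition tensor_eval ::
  "('k::field, 'o, 'm::ab_group_add, 'z) mon_cat_scheme \<Rightarrow> ('m \<times> 'm \<Rightarrow>\<^sub>0 'k) \<Rightarrow> 'm" where
  "tensor_eval C t =
     (\<Sum>(f, g) \<in> Poly_Mapping.keys t. scl C (Poly_Mapping.lookup t (f, g)) (f \<otimes>\<^bsub>C\<^esub> g))"

definition tensor_map ::
  "('k::field, 'o, 'm::ab_group_add, 'z) mon_cat_scheme \<Rightarrow> ('m \<times> 'm \<Rightarrow>\<^sub>0 'k) set \<Rightarrow> 'm" where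
  "tensor_map C T = the_elem (tensor_eval C ` T)"

definition faithfully_prime ::
  "('k::field, 'o, 'm::ab_group_add, 'z) mon_cat_scheme \<Rightarrow> ('o \<Rightarrow> 'o \<Rightarrow> 'm set) \<Rightarrow> bool" where
  "faithfully_prime C I \<longleftrightarrow>
     tensor_ideal C I \<and> I \<noteq> Hom C \<and>
     (\<forall>X Y U V.
        {T \<in> tensor_space (scl C) (Hom C X Y) (Hom C U V).
           tensor_map C T \<in> I (X \<odot>\<^bsub>C\<^esub> U) (Y \<odot>\<^bsub>C\<^esub> V)}
        = tensor_subspace_sum (scl C) (I X Y) (Hom C X Y) (I U V) (Hom C U V))"

end

theory Submission
  imports Defs
begin

text \<open>
  For a thick tensor ideal \<open>J\<close> let \<open>K J\<close> (\<open>largest_ideal\<close> below) consist of the morphisms \<open>f\<close> such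
  that every object whose identity factors through some \<open>Z \<otimes> f\<close> lies in \<open>J\<close>. Any tensor ideal
  with objects in \<open>J\<close> is contained in \<open>K J\<close>, since it contains the identity of each such object.
  That \<open>K J\<close> is closed under sums is a form of the Krull-Schmidt property: if \<open>u + v\<close> is the
  identity of \<open>W\<close>, the Fitting idempotent of \<open>u\<close> splits \<open>W\<close> into a summand on which \<open>u\<close> is
  invertible and one on which \<open>v\<close> is (\<open>Id_sum_direct_sum\<close>). Closure under tensoring on the right
  comes from the commutor. So \<open>K J\<close> is the largest tensor ideal with objects \<open>J\<close>.

  If \<open>J\<close> is prime then so is \<open>K J\<close>: when \<open>f\<close> and \<open>g\<close> are outside \<open>K J\<close>, identities of objects
  \<open>W\<close>, \<open>W'\<close> outside \<open>J\<close> factor through \<open>Z \<otimes> f\<close> and \<open>T \<otimes> g\<close>, so the identity of \<open>W \<otimes> W'\<close> factors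
  through \<open>(Z \<otimes> f) \<otimes> (T \<otimes> g)\<close>. The commutor allows \<open>T\<close> to be moved past \<open>f\<close>, so this morphism
  would lie in \<open>K J\<close> if \<open>f \<otimes> g\<close> did.

  Conversely let \<open>I\<close> be a prime tensor ideal with objects \<open>J\<close>, and \<open>f\<close> in \<open>K J\<close>. A morphism in
  \<open>K J\<close> is the sum of one in the radical and one in \<open>I\<close> (\<open>largest_ideal_radical_decomp\<close>). A tensor power of \<open>f\<close> with \<open>n\<close> factors is a composite of \<open>n\<close>
  morphisms in \<open>K J\<close>, so modulo \<open>I\<close> it lies in the \<open>n\<close>-th power of the radical, which vanishes for
  large \<open>n\<close>. Primality then puts \<open>f\<close> itself into \<open>I\<close>. Hence \<open>I = K J\<close>.

  For faithful primality over an algebraically closed field the point is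
  \<open>dependence_mod_prime_tensor_ideal\<close>: if \<open>h \<otimes> g + (\<Sum>i. h\<^sub>i \<otimes> g\<^sub>i)\<close> is in \<open>I\<close> and \<open>h\<close> is not, then
  \<open>g\<close> is a combination of the \<open>g\<^sub>i\<close> modulo \<open>I\<close>. As \<open>I = K J\<close>, one may replace \<open>h\<close> by the identity
  of an object outside \<open>J\<close> and the \<open>h\<^sub>i\<close> by endomorphisms \<open>u\<^sub>i\<close> of it; composing with an eigenvector
  of \<open>u\<^sub>k\<close> modulo \<open>I\<close> merges the \<open>k\<close>-th summand into the first, and induction on the number of
  summands applies. The dependence shortens any tensor whose image is in \<open>I\<close>, until all its
  summands have a factor in \<open>I\<close>.
\<close>

section \<open>Polynomials in an endomorphism and Fitting idempotents\<close>

text \<open>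
  The polynomial form of Fitting's lemma: modulo \<open>p\<close>, the two summands of \<open>1\<close> are orthogonal
  idempotents, the first a multiple of \<open>x\<close> and the second a multiple of \<open>1 - x\<close>. Away from the
  root \<open>0\<close> of \<open>p\<close> one can divide by \<open>x\<close>, and at that root by \<open>1 - x\<close>.
\<close>

lemma polynomial_splitting:
  fixes p :: "'k::field poly"
  assumes "p \<noteq> 0"
  shows "\<exists>Q R. [:0, 1:] * Q + [:1, -1:] * R = 1 \<and> p dvd ([:0, 1:] * Q) * ([:1, -1:] * R)"
proof -
  define X :: "'k poly" where "X = [:0, 1:]"
  \<comment> \<open>The extra factors only strengthen the divisibility; they make the idempotents divisible
      by \<open>x\<close> and by \<open>1 - x\<close>.\<close>
  define p' where "p' = X * [:1, -1:] * p"
  have "X \<noteq> 0" "[:1, -1:] \<noteq> (0 :: 'k poly)" by (simp_all add: X_def)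
  then have "p' \<noteq> 0" unfolding p'_def using assms by (simp only: mult_eq_0_iff) simp
  define m where "m = order 0 p'"
  from order_decomp[OF \<open>p' \<noteq> 0\<close>, of 0] obtain r where r: "p' = X ^ m * r" "\<not> X dvd r"
    by (auto simp: m_def X_def)
  have "X dvd p'" unfolding p'_def mult.assoc by (rule dvd_triv_left)
  then have m: "m > 0" using r by (cases m) auto
  have "poly r 1 = 0"
    using arg_cong[OF r(1), of "\<lambda>q. poly q 1"] by (simp add: p'_def X_def)
  then have "[:-1, 1:] dvd r" by (simp add: poly_eq_0_iff_dvd)
  then have "- [:-1, 1:] dvd r" by (simp only: minus_dvd_iff)
  then have r1: "[:1, -1:] dvd r" by simp
  have r0: "poly r 0 \<noteq> 0"
    using r(2) by (auto simp: X_def poly_eq_0_iff_dvd)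
  \<comment> \<open>\<open>y ^ m\<close> is the first idempotent: \<open>y\<close> is divisible by \<open>x\<close>, and congruent to \<open>1\<close> modulo \<open>r\<close>.\<close>
  define y where "y = 1 - smult (inverse (poly r 0)) r"
  have "poly y 0 = 0" using r0 by (simp add: y_def)
  then have "X dvd y" by (simp add: X_def poly_eq_0_iff_dvd)
  have "y dvd y ^ m" using m by (simp add: dvd_power)
  with \<open>X dvd y\<close> have "X dvd y ^ m" by (rule dvd_trans)
  then obtain Q where Q: "y ^ m = X * Q" ..
  have "1 - y dvd 1 - y ^ m"
  proof -
    have "y - 1 dvd y ^ m - 1" by (metis dvd_triv_left power_diff_1_eq)
    then have "- (y - 1) dvd - (y ^ m - 1)" by (simp only: minus_dvd_iff dvd_minus_iff)
    then show ?thesis by simp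
  qed
  moreover have "r dvd 1 - y"
    by (simp add: y_def dvd_smult)
  ultimately have r2: "r dvd 1 - y ^ m" by (rule dvd_trans[rotated])
  with r1 have "[:1, -1:] dvd 1 - y ^ m" by (rule dvd_trans)
  then obtain R where R: "1 - y ^ m = [:1, -1:] * R" ..
  have "X ^ m dvd y ^ m" using \<open>X dvd y\<close> by (rule dvd_power_same)
  then have "p' dvd y ^ m * (1 - y ^ m)"
    unfolding r(1) using r2 by (rule mult_dvd_mono)
  moreover have "p dvd p'" by (simp add: p'_def)
  ultimately have "p dvd y ^ m * (1 - y ^ m)" by (rule dvd_trans[rotated])
  then have "X * Q + [:1, -1:] * R = 1 \<and> p dvd (X * Q) * ([:1, -1:] * R)"
    unfolding Q[symmetric] R[symmetric] by simp
  then show ?thesis unfolding X_def by blast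
qed

context linear_category
begin

lemma Hom_zero: "0 \<in> Hom C X Y"
  and Hom_add: "\<lbrakk>f \<in> Hom C X Y; g \<in> Hom C X Y\<rbrakk> \<Longrightarrow> f + g \<in> Hom C X Y"
  and Hom_diff: "\<lbrakk>f \<in> Hom C X Y; g \<in> Hom C X Y\<rbrakk> \<Longrightarrow> f - g \<in> Hom C X Y"
  and Hom_scl: "f \<in> Hom C X Y \<Longrightarrow> scl C c f \<in> Hom C X Y"
  using subspace_Hom[of X Y]
  by (auto intro: subspace_0 subspace_add subspace_diff subspace_scale)

lemma Hom_sum: "(\<And>i. i \<in> A \<Longrightarrow> f i \<in> Hom C X Y) \<Longrightarrow> sum f A \<in> Hom C X Y"
  by (rule subspace_sum[OF subspace_Hom])

lemmas Hom_closed = Id_in_Hom Hom_zero Hom_add Hom_diff Hom_scl Hom_sum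

lemma Comp_zero_left: "f \<in> Hom C X Y \<Longrightarrow> 0 \<cdot> f = 0"
  using Comp_scl_left[of f X Y 0 Y 0] by (simp add: Hom_zero)

lemma Comp_zero_right: "g \<in> Hom C X Y \<Longrightarrow> g \<cdot> 0 = 0"
  using Comp_scl_right[of 0 X X g Y 0] by (simp add: Hom_zero)

lemma Comp_diff_left:
  assumes "f \<in> Hom C X Y" "g \<in> Hom C Y Z" "g' \<in> Hom C Y Z"
  shows "(g - g') \<cdot> f = g \<cdot> f - g' \<cdot> f"
  using Comp_add_left[of f X Y "g - g'" Z g'] assms by (simp add: Hom_diff)

lemma Comp_diff_right:
  assumes "f \<in> Hom C X Y" "f' \<in> Hom C X Y" "g \<in> Hom C Y Z"
  shows "g \<cdot> (f - f') = g \<cdot> f - g \<cdot> f'"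
  using Comp_add_right[of "f - f'" X Y f' g Z] assms by (simp add: Hom_diff)

lemma Comp_sum_list_right:
  assumes "g \<in> Hom C Y Z" "\<forall>f \<in> set fs. f \<in> Hom C X Y"
  shows "sum_list fs \<in> Hom C X Y \<and> g \<cdot> sum_list fs = sum_list (map (\<lambda>f. g \<cdot> f) fs)"
  using assms(2)
  by (induction fs) (auto simp: Hom_zero Hom_add Comp_zero_right[OF assms(1)] Comp_add_right[OF _ _ assms(1)])

text \<open>
  Horner evaluation in the algebra \<open>Hom C W W\<close>. It cannot be \<^const>\<open>poly\<close>, because the endomorphisms
  of \<open>W\<close> are a subset of \<^typ>\<open>'m\<close> and not a type.
\<close>

definition poly_end :: "'o \<Rightarrow> 'm \<Rightarrow> 'k poly \<Rightarrow> 'm" where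
  "poly_end W u p = fold_coeffs (\<lambda>a r. scl C a (Id C W) + u \<cdot> r) p 0"

context
  fixes W u assumes u: "u \<in> Hom C W W"
begin

lemma poly_end_0: "poly_end W u 0 = 0"
  by (simp add: poly_end_def)

lemma poly_end_pCons: "poly_end W u (pCons a p) = scl C a (Id C W) + u \<cdot> poly_end W u p"
  by (cases "p = 0"; cases "a = 0") (simp_all add: poly_end_def Comp_zero_right[OF u])

lemma poly_end_in_Hom: "poly_end W u p \<in> Hom C W W"
  by (induction p) (auto simp: poly_end_0 poly_end_pCons intro!: Hom_closed Comp_in_Hom[OF _ u])

lemma poly_end_add: "poly_end W u (p + q) = poly_end W u p + poly_end W u q"
  by (induction p q rule: poly_induct2)
    (simp_all add: poly_end_0 poly_end_pCons scale_left_distrib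
      Comp_add_right[OF poly_end_in_Hom poly_end_in_Hom u])

lemma poly_end_smult: "poly_end W u (smult c p) = scl C c (poly_end W u p)"
  by (induction p)
    (simp_all add: poly_end_0 poly_end_pCons scale_right_distrib Comp_scl_right[OF poly_end_in_Hom u])

lemma poly_end_sum: "poly_end W u (sum p A) = (\<Sum>i\<in>A. poly_end W u (p i))"
  by (induction A rule: infinite_finite_induct) (simp_all add: poly_end_0 poly_end_add)

lemma poly_end_mult: "poly_end W u (p * q) = poly_end W u p \<cdot> poly_end W u q"
proof (induction p)
  case 0
  show ?case by (simp add: poly_end_0 Comp_zero_left[OF poly_end_in_Hom])
next
  case (pCons a p)
  have "(scl C a (Id C W) + u \<cdot> poly_end W u p) \<cdot> poly_end W u q
      = scl C a (Id C W) \<cdot> poly_end W u q + u \<cdot> poly_end W u p \<cdot> poly_end W u q"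
    by (intro Comp_add_left[of _ W W _ W] poly_end_in_Hom Hom_scl Id_in_Hom Comp_in_Hom[OF _ u])
  also have "scl C a (Id C W) \<cdot> poly_end W u q = scl C a (poly_end W u q)"
    by (simp add: Comp_scl_left[OF poly_end_in_Hom Id_in_Hom] Comp_Id_left[OF poly_end_in_Hom])
  also have "u \<cdot> poly_end W u p \<cdot> poly_end W u q = u \<cdot> (poly_end W u p \<cdot> poly_end W u q)"
    by (rule Comp_assoc[symmetric, OF poly_end_in_Hom poly_end_in_Hom u])
  finally show ?case
    by (simp add: poly_end_pCons poly_end_add poly_end_smult pCons.IH)
qed

lemma poly_end_const: "poly_end W u [:c:] = scl C c (Id C W)"
  by (simp add: poly_end_pCons poly_end_0 Comp_zero_right[OF u])

lemma poly_end_1: "poly_end W u 1 = Id C W"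
  unfolding one_pCons by (simp add: poly_end_const)

lemma poly_end_linear: "poly_end W u [:c, d:] = scl C c (Id C W) + scl C d u"
  by (simp add: poly_end_pCons poly_end_const Comp_scl_right[OF Id_in_Hom u] Comp_Id_right[OF u]
      poly_end_0 Comp_zero_right[OF u])

text \<open>In dimension \<open>d\<close> the powers of \<open>u\<close> with exponents \<open>0, \<dots>, d\<close> coincide somewhere or are dependent.\<close>

lemma ex_annihilating_poly:
  assumes "finite B" "span B = Hom C W W"
  shows "\<exists>p. p \<noteq> 0 \<and> poly_end W u p = 0"
proof -
  define v where "v i = poly_end W u (monom 1 i)" for i
  define A where "A = {..card B}"
  show ?thesis
  proof (cases "inj_on v A")
    case False
    then obtain i j where ij: "i \<noteq> j" "v i = v j" by (auto simp: inj_on_def)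
    let ?p = "monom 1 i + smult (-1) (monom 1 j) :: 'k poly"
    have "coeff ?p i = 1" using ij by simp
    then have "?p \<noteq> 0" by (metis coeff_0 zero_neq_one)
    moreover have "poly_end W u ?p = 0"
      unfolding poly_end_add poly_end_smult using ij(2) by (simp add: v_def)
    ultimately show ?thesis by blast
  next
    case True
    have "v ` A \<subseteq> span B" using poly_end_in_Hom by (auto simp: v_def assms)
    moreover have "card (v ` A) > card B" using True by (simp add: card_image A_def)
    ultimately have "dependent (v ` A)"
      using independent_span_bound[OF assms(1), of "v ` A"] by auto
    then obtain c where c: "\<exists>x \<in> v ` A. c x \<noteq> 0" "(\<Sum>x\<in>v ` A. scl C (c x) x) = 0"
      by (auto simp: dependent_finite A_def)
    let ?p = "\<Sum>i\<in>A. smult (c (v i)) (monom 1 i)"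
    from c(1) obtain i where i: "i \<in> A" "c (v i) \<noteq> 0" by auto
    have "coeff ?p i = (\<Sum>j\<in>A. if j = i then c (v j) else 0)"
      unfolding coeff_sum by (intro sum.cong) auto
    then have "coeff ?p i = c (v i)" using i by (simp add: A_def)
    then have "?p \<noteq> 0" using i by force
    moreover have "poly_end W u ?p = (\<Sum>i\<in>A. scl C (c (v i)) (v i))"
      by (simp add: poly_end_sum poly_end_smult v_def)
    then have "poly_end W u ?p = 0"
      using c(2) sum.reindex[OF True, of "\<lambda>x. scl C (c x) x"] by simp
    ultimately show ?thesis by blast
  qed
qed

text \<open>
  The idempotent \<open>u \<cdot> q\<close> projects onto the part of \<open>W\<close> on which \<open>u\<close> is invertible. On the complement
  \<open>u\<close> is nilpotent, hence \<open>Id - u\<close> is invertible there, with \<open>w\<close> as its inverse.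
\<close>

lemma fitting_idempotent:
  assumes "finite B" "span B = Hom C W W"
  obtains q w where "q \<in> Hom C W W" "w \<in> Hom C W W"
    "q \<cdot> u = u \<cdot> q" "(u \<cdot> q) \<cdot> (u \<cdot> q) = u \<cdot> q"
    "w \<cdot> (Id C W - u) = Id C W - u \<cdot> q" "(Id C W - u) \<cdot> w = Id C W - u \<cdot> q"
proof -
  obtain p where p: "p \<noteq> 0" "poly_end W u p = 0" using ex_annihilating_poly[OF assms] by blast
  obtain Q R where QR: "[:0, 1:] * Q + [:1, -1:] * R = 1" "p dvd ([:0, 1:] * Q) * ([:1, -1:] * R)"
    using polynomial_splitting[OF p(1)] by blast
  define q w where "q = poly_end W u Q" and "w = poly_end W u R"
  have x: "poly_end W u [:0, 1:] = u" "poly_end W u [:1, -1:] = Id C W - u"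
    by (simp_all add: poly_end_linear)
  have uq: "poly_end W u ([:0, 1:] * Q) = u \<cdot> q"
    and uw: "poly_end W u ([:1, -1:] * R) = (Id C W - u) \<cdot> w"
    unfolding poly_end_mult x q_def w_def by simp_all
  have sum: "u \<cdot> q + (Id C W - u) \<cdot> w = Id C W"
    using arg_cong[OF QR(1), of "poly_end W u"] unfolding poly_end_add uq uw poly_end_1 .
  from QR(2) obtain s where "([:0, 1:] * Q) * ([:1, -1:] * R) = p * s" ..
  then have "poly_end W u (([:0, 1:] * Q) * ([:1, -1:] * R)) = poly_end W u p \<cdot> poly_end W u s"
    by (simp only: poly_end_mult[symmetric])
  then have prod: "(u \<cdot> q) \<cdot> ((Id C W - u) \<cdot> w) = 0"
    unfolding poly_end_mult[of "[:0, 1:] * Q"] uq uw p(2) Comp_zero_left[OF poly_end_in_Hom] .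
  have eq: "(Id C W - u) \<cdot> w = Id C W - u \<cdot> q"
    using sum by (simp add: algebra_simps)
  show thesis
  proof
    show q: "q \<in> Hom C W W" and "w \<in> Hom C W W"
      unfolding q_def w_def by (rule poly_end_in_Hom)+
    show "q \<cdot> u = u \<cdot> q"
      unfolding uq[symmetric] mult.commute[of "[:0, 1:]"]
      unfolding poly_end_mult x q_def ..
    show "(Id C W - u) \<cdot> w = Id C W - u \<cdot> q" by (fact eq)
    show "w \<cdot> (Id C W - u) = Id C W - u \<cdot> q"
      unfolding eq[symmetric] uw[symmetric] mult.commute[of "[:1, -1:]"]
      unfolding poly_end_mult x w_def ..
    have "u \<cdot> q \<in> Hom C W W" using Comp_in_Hom[OF q u] .
    then show "(u \<cdot> q) \<cdot> (u \<cdot> q) = u \<cdot> q"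
      using prod unfolding eq by (simp add: Comp_diff_right[OF Id_in_Hom] Comp_Id_right)
  qed
qed

end

lemma dim_strict_mono:
  assumes "finite B" "T \<subseteq> span B" "subspace S" "S \<subset> T"
  shows "dim S < dim T"
proof -
  obtain b where b: "b \<subseteq> S" "independent b" "S \<subseteq> span b" "card b = dim S"
    by (rule basis_exists)
  obtain c where c: "c \<subseteq> T" "independent c" "T \<subseteq> span c" "card c = dim T"
    by (rule basis_exists)
  from assms(4) obtain x where x: "x \<in> T" "x \<notin> S" by blast
  have "x \<notin> span b" using b(1) assms(3) x(2) span_minimal by blast
  with b(2) have ind: "independent (insert x b)" by (simp add: independent_insertI)
  have "finite c" using independent_span_bound[OF assms(1) c(2)] c(1) assms(2) by blast
  from independent_span_bound[OF this ind]
  have "finite (insert x b) \<and> card (insert x b) \<le> card c"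
    using b(1) c(3) x(1) assms(4) by (auto simp: subset_iff)
  moreover have "x \<notin> b" using b(1) x(2) by blast
  ultimately have "Suc (card b) \<le> card c" by (metis card_insert_disjoint finite_insert)
  then show ?thesis using b(4) c(4) by simp
qed


lemma iso_morE:
  assumes "iso_mor C X Y f"
  obtains g where "f \<in> Hom C X Y" "g \<in> Hom C Y X" "g \<cdot> f = Id C X" "f \<cdot> g = Id C Y"
  using assms by (auto simp: iso_mor_def inverse_mors_def)

lemma iso_morI:
  "\<lbrakk>f \<in> Hom C X Y; g \<in> Hom C Y X; g \<cdot> f = Id C X; f \<cdot> g = Id C Y\<rbrakk> \<Longrightarrow> iso_mor C X Y f"
  by (auto simp: iso_mor_def inverse_mors_def)

lemma iso_mor_Id: "iso_mor C X X (Id C X)"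
  by (rule iso_morI[of _ _ _ "Id C X"]) (simp_all add: Id_in_Hom Comp_Id_left[OF Id_in_Hom])

end

section \<open>Tensor ideals and their objects\<close>

context linear_monoidal_category
begin

lemma iso_mor_TensM:
  assumes "iso_mor C X Y f" "iso_mor C U V g"
  shows "iso_mor C (X \<odot> U) (Y \<odot> V) (f \<otimes> g)"
proof -
  obtain f' where f: "f \<in> Hom C X Y" "f' \<in> Hom C Y X" "f' \<cdot> f = Id C X" "f \<cdot> f' = Id C Y"
    using assms(1) by (rule iso_morE)
  obtain g' where g: "g \<in> Hom C U V" "g' \<in> Hom C V U" "g' \<cdot> g = Id C U" "g \<cdot> g' = Id C V"
    using assms(2) by (rule iso_morE)
  show ?thesis
  proof (rule iso_morI)
    show "f' \<otimes> g' \<cdot> f \<otimes> g = Id C (X \<odot> U)" "f \<otimes> g \<cdot> f' \<otimes> g' = Id C (Y \<odot> V)"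
      using TensM_Comp[OF f(1,2) g(1,2)] TensM_Comp[OF f(2,1) g(2,1)] f g
      by (simp_all add: TensM_Id)
  qed (use f g in \<open>auto intro: TensM_in_Hom\<close>)
qed

lemma TensM_factor:
  assumes f: "f \<in> Hom C X Y" and g: "g \<in> Hom C U V"
  shows "f \<otimes> g = (f \<otimes> Id C V) \<cdot> (Id C X \<otimes> g)"
  using TensM_Comp[OF Id_in_Hom f g Id_in_Hom] f g by (simp add: Comp_Id_left Comp_Id_right)

lemma TensM_Comp_Id_left:
  assumes f: "f \<in> Hom C X Y" and g: "g \<in> Hom C Y Z"
  shows "Id C T \<otimes> (g \<cdot> f) = (Id C T \<otimes> g) \<cdot> (Id C T \<otimes> f)"
  using TensM_Comp[OF Id_in_Hom Id_in_Hom f g] by (simp add: Comp_Id_left[OF Id_in_Hom])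

lemma TensM_sum_right:
  assumes "\<And>i. i \<in> A \<Longrightarrow> g i \<in> Hom C U V" "f \<in> Hom C X Y"
  shows "f \<otimes> (\<Sum>i\<in>A. g i) = (\<Sum>i\<in>A. f \<otimes> g i)"
proof -
  have "f \<otimes> 0 = 0"
    using TensM_scl_right[of f X Y 0 U V 0] assms(2) by (simp add: Hom_zero)
  then show ?thesis using assms
    by (induction A rule: infinite_finite_induct)
      (simp_all add: TensM_add_right[of _ X Y _ U V] Hom_sum)
qed

lemma
  assumes "tensor_ideal C I"
  shows tensor_ideal_subspace: "subspace (I X Y)"
    and tensor_ideal_in_Hom: "f \<in> I X Y \<Longrightarrow> f \<in> Hom C X Y"
    and tensor_ideal_Comp_left: "\<lbrakk>f \<in> I X Y; g \<in> Hom C Y Z\<rbrakk> \<Longrightarrow> g \<cdot> f \<in> I X Z"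
    and tensor_ideal_Comp_right: "\<lbrakk>f \<in> Hom C X Y; g \<in> I Y Z\<rbrakk> \<Longrightarrow> g \<cdot> f \<in> I X Z"
    and tensor_ideal_Id_TensM: "f \<in> I X Y \<Longrightarrow> Id C Z \<otimes> f \<in> I (Z \<odot> X) (Z \<odot> Y)"
    and tensor_ideal_TensM_Id: "f \<in> I X Y \<Longrightarrow> f \<otimes> Id C Z \<in> I (X \<odot> Z) (Y \<odot> Z)"
  using assms unfolding tensor_ideal_def by blast+

lemma tensor_ideal_TensM:
  assumes "tensor_ideal C I" "f \<in> Hom C X Y" "g \<in> Hom C U V" "f \<in> I X Y \<or> g \<in> I U V"
  shows "f \<otimes> g \<in> I (X \<odot> U) (Y \<odot> V)"
  unfolding TensM_factor[OF assms(2,3)] using assms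
  by (meson Id_in_Hom TensM_in_Hom tensor_ideal_Comp_left tensor_ideal_Comp_right
      tensor_ideal_Id_TensM tensor_ideal_TensM_Id)

lemma tensor_ideal_iso_cong:
  assumes I: "tensor_ideal C I" and a: "iso_mor C X X' a" and b: "iso_mor C Y Y' b"
    and f: "f \<in> Hom C X Y" and f': "f' \<in> Hom C X' Y'" and eq: "b \<cdot> f = f' \<cdot> a"
  shows "f \<in> I X Y \<longleftrightarrow> f' \<in> I X' Y'"
proof -
  obtain a' where a: "a \<in> Hom C X X'" "a' \<in> Hom C X' X" "a' \<cdot> a = Id C X" "a \<cdot> a' = Id C X'"
    using a by (rule iso_morE)
  obtain b' where b: "b \<in> Hom C Y Y'" "b' \<in> Hom C Y' Y" "b' \<cdot> b = Id C Y" "b \<cdot> b' = Id C Y'"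
    using b by (rule iso_morE)
  have "f' = (b \<cdot> f) \<cdot> a'"
    unfolding eq Comp_assoc[OF a(2,1) f', symmetric] a(4) by (rule Comp_Id_right[OF f', symmetric])
  moreover have "f = b' \<cdot> (f' \<cdot> a)"
    unfolding eq[symmetric] Comp_assoc[OF f b(1,2)] b(3) by (rule Comp_Id_left[OF f, symmetric])
  ultimately show ?thesis
    by (metis I a b tensor_ideal_Comp_left tensor_ideal_Comp_right)
qed

lemma tensor_ideal_Ob_retract:
  assumes I: "tensor_ideal C I" and V: "V \<in> Ob C I"
    and s: "s \<in> Hom C W V" and r: "r \<in> Hom C V W" and rs: "r \<cdot> s = Id C W"
  shows "W \<in> Ob C I"
proof -
  have "r \<cdot> (Id C V \<cdot> s) \<in> I W W"
    using V by (intro tensor_ideal_Comp_left[OF I _ r] tensor_ideal_Comp_right[OF I s]) (simp add: Ob_def)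
  then show ?thesis using s rs by (simp add: Ob_def Comp_Id_left)
qed

lemma tensor_ideal_Ob_iff:
  assumes I: "tensor_ideal C I"
  shows "X \<in> Ob C I \<longleftrightarrow> (\<forall>Y. I X Y = Hom C X Y \<and> I Y X = Hom C Y X)"
proof
  assume X: "X \<in> Ob C I"
  then have "f \<in> I X Y" if "f \<in> Hom C X Y" for f Y
    using tensor_ideal_Comp_left[OF I _ that, of "Id C X" X] that by (simp add: Ob_def Comp_Id_right)
  moreover from X have "f \<in> I Y X" if "f \<in> Hom C Y X" for f Y
    using tensor_ideal_Comp_right[OF I that, of "Id C X" X] that by (simp add: Ob_def Comp_Id_left)
  ultimately show "\<forall>Y. I X Y = Hom C X Y \<and> I Y X = Hom C Y X"
    using tensor_ideal_in_Hom[OF I] by blast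
qed (auto simp: Ob_def Id_in_Hom)

lemma thick_tensor_ideal_Ob:
  assumes I: "tensor_ideal C I"
  shows "thick_tensor_ideal C (Ob C I)"
  unfolding thick_tensor_ideal_def
proof (intro conjI allI impI ballI)
  fix X Y assume "X \<in> Ob C I \<and> isomorphic_objs C X Y"
  then show "Y \<in> Ob C I"
    by (auto simp: isomorphic_objs_def elim!: iso_morE intro: tensor_ideal_Ob_retract[OF I])
next
  fix X Y assume "X \<in> Ob C I"
  then show "Y \<odot> X \<in> Ob C I" "X \<odot> Y \<in> Ob C I"
    unfolding Ob_def mem_Collect_eq TensM_Id[symmetric]
    by (blast intro: tensor_ideal_Id_TensM[OF I] tensor_ideal_TensM_Id[OF I])+
next
  fix Z assume "is_zero_object C Z"
  then have "Id C Z = 0" using Id_in_Hom[of Z] by (auto simp: is_zero_object_def)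
  then show "Z \<in> Ob C I" using subspace_0[OF tensor_ideal_subspace[OF I]] by (simp add: Ob_def)
next
  fix X X1 X2 assume "is_direct_sum C X X1 X2"
  then obtain i1 i2 p1 p2 where *: "i1 \<in> Hom C X1 X" "i2 \<in> Hom C X2 X" "p1 \<in> Hom C X X1" "p2 \<in> Hom C X X2"
    "p1 \<cdot> i1 = Id C X1" "p2 \<cdot> i2 = Id C X2" "i1 \<cdot> p1 + i2 \<cdot> p2 = Id C X"
    unfolding is_direct_sum_def by blast
  show "(X \<in> Ob C I) = (X1 \<in> Ob C I \<and> X2 \<in> Ob C I)"
  proof
    assume "X \<in> Ob C I"
    then show "X1 \<in> Ob C I \<and> X2 \<in> Ob C I" using * by (blast intro: tensor_ideal_Ob_retract[OF I])
  next
    assume "X1 \<in> Ob C I \<and> X2 \<in> Ob C I"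
    then have "i1 \<in> I X1 X" "i2 \<in> I X2 X" using * by (auto simp: tensor_ideal_Ob_iff[OF I])
    then have "i1 \<cdot> p1 + i2 \<cdot> p2 \<in> I X X" using *
      by (blast intro: subspace_add tensor_ideal_subspace[OF I] tensor_ideal_Comp_right[OF I])
    then show "X \<in> Ob C I" by (simp add: * Ob_def)
  qed
qed

lemma tensor_ideal_one_in_Ob:
  assumes I: "tensor_ideal C I" and one: "\<one> \<in> Ob C I"
  shows "I = Hom C"
proof -
  have "X \<in> Ob C I" for X
  proof -
    have "\<one> \<odot> X \<in> Ob C I"
      using thick_tensor_ideal_Ob[OF I] one unfolding thick_tensor_ideal_def by blast
    then show ?thesis
      using LUnit_iso[of X] by (blast elim: iso_morE intro: tensor_ideal_Ob_retract[OF I])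
  qed
  then have "I X Y = Hom C X Y" for X Y by (simp add: tensor_ideal_Ob_iff[OF I])
  then show ?thesis by (intro ext)
qed

lemma prime_thick_tensor_ideal_Ob:
  assumes "prime_tensor_ideal C I"
  shows "prime_thick_tensor_ideal C (Ob C I)"
proof -
  have I: "tensor_ideal C I" and ne: "I \<noteq> Hom C"
    and prime: "\<And>X Y U V f g. \<lbrakk>f \<in> Hom C X Y; g \<in> Hom C U V;
      f \<otimes> g \<in> I (X \<odot> U) (Y \<odot> V)\<rbrakk> \<Longrightarrow> f \<in> I X Y \<or> g \<in> I U V"
    using assms unfolding prime_tensor_ideal_def by blast+
  show ?thesis
    unfolding prime_thick_tensor_ideal_def
  proof (intro conjI allI impI)
    fix X Y assume "X \<odot> Y \<in> Ob C I"
    then show "X \<in> Ob C I \<or> Y \<in> Ob C I"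
      using prime[OF Id_in_Hom[of X] Id_in_Hom[of Y]] by (simp add: Ob_def TensM_Id)
  qed (use thick_tensor_ideal_Ob[OF I] tensor_ideal_one_in_Ob[OF I] ne in auto)
qed

end
section \<open>Retracts and direct summands\<close>

context pseudo_tensor_category
begin

lemma retract_complement:
  assumes s: "s \<in> Hom C W V" and r: "r \<in> Hom C V W" and rs: "r \<cdot> s = Id C W"
  obtains W' s' r' where "s' \<in> Hom C W' V" "r' \<in> Hom C V W'" "r' \<cdot> s' = Id C W'"
    "s' \<cdot> r' = Id C V - s \<cdot> r" "is_direct_sum C V W W'"
proof -
  define e where "e = s \<cdot> r"
  have e: "e \<in> Hom C V V" unfolding e_def by (rule Comp_in_Hom[OF r s])
  have es: "e \<cdot> s = s" unfolding e_def Comp_assoc[OF s r s, symmetric] rs by (rule Comp_Id_right[OF s])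
  have re: "r \<cdot> e = r" unfolding e_def Comp_assoc[OF r s r] rs by (rule Comp_Id_left[OF r])
  have ee: "e \<cdot> e = e" using Comp_assoc[OF r s e] unfolding es e_def[symmetric] re by simp
  define d where "d = Id C V - e"
  have d: "d \<in> Hom C V V" unfolding d_def by (intro Hom_diff Id_in_Hom e)
  have dd: "d \<cdot> d = d"
    unfolding d_def Comp_diff_left[OF d[unfolded d_def] Id_in_Hom e] Comp_diff_right[OF Id_in_Hom e e]
    using e Comp_Id_left[OF d[unfolded d_def]] by (simp add: ee Comp_Id_right)
  have ds: "d \<cdot> s = 0"
    unfolding d_def Comp_diff_left[OF s Id_in_Hom e] es Comp_Id_left[OF s] by simp
  have rd: "r \<cdot> d = 0"
    unfolding d_def Comp_diff_right[OF Id_in_Hom e r] re Comp_Id_right[OF r] by simp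
  from idempotent_complete[OF d dd] obtain W' r' s' where
    r': "r' \<in> Hom C V W'" and s': "s' \<in> Hom C W' V" and rs': "r' \<cdot> s' = Id C W'" and sr': "s' \<cdot> r' = d"
    by blast
  have "r' \<cdot> d = r'" unfolding sr'[symmetric] Comp_assoc[OF r' s' r'] rs' by (rule Comp_Id_left[OF r'])
  then have 1: "r' \<cdot> s = 0"
    using Comp_assoc[OF s d r'] Comp_zero_right[OF r'] by (simp add: ds)
  have "d \<cdot> s' = s'" unfolding sr'[symmetric] Comp_assoc[OF s' r' s', symmetric] rs' by (rule Comp_Id_right[OF s'])
  then have 2: "r \<cdot> s' = 0"
    using Comp_assoc[OF s' d r] Comp_zero_left[OF s'] by (simp add: rd)
  have "is_direct_sum C V W W'"
    unfolding is_direct_sum_def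
    by (rule bexI[OF _ s], rule bexI[OF _ s'], rule bexI[OF _ r], rule bexI[OF _ r'])
      (simp add: rs rs' 1 2 sr' d_def e_def)
  with s' r' rs' sr' show thesis unfolding d_def e_def by (rule that)
qed

lemma idempotent_direct_sum:
  assumes e: "e \<in> Hom C V V" "e \<cdot> e = e"
  obtains W1 W2 s1 r1 s2 r2 where
    "s1 \<in> Hom C W1 V" "r1 \<in> Hom C V W1" "r1 \<cdot> s1 = Id C W1" "s1 \<cdot> r1 = e"
    "s2 \<in> Hom C W2 V" "r2 \<in> Hom C V W2" "r2 \<cdot> s2 = Id C W2" "s2 \<cdot> r2 = Id C V - e"
    "is_direct_sum C V W1 W2"
proof -
  from idempotent_complete[OF e] obtain W r s where
    *: "s \<in> Hom C W V" "r \<in> Hom C V W" "r \<cdot> s = Id C W" "s \<cdot> r = e" by blast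
  from *(1,2,3) show thesis
    by (rule retract_complement) (rule that[OF *], simp_all add: *(4))
qed

text \<open>
  This stands in for the fact that one of two summands of the identity of an indecomposable object
  is invertible: \<open>W\<close> splits into a part whose identity factors through \<open>u\<close> and one whose identity
  factors through \<open>v\<close>, namely the two parts of the Fitting decomposition for \<open>u\<close>.
\<close>

lemma Id_sum_direct_sum:
  assumes u: "u \<in> Hom C W W" and v: "v \<in> Hom C W W" and uv: "u + v = Id C W"
  obtains W1 W2 s1 r1 s2 r2 where
    "s1 \<in> Hom C W1 W" "r1 \<in> Hom C W W1" "r1 \<cdot> (u \<cdot> s1) = Id C W1"
    "s2 \<in> Hom C W2 W" "r2 \<in> Hom C W W2" "r2 \<cdot> (v \<cdot> s2) = Id C W2"
    "is_direct_sum C W W1 W2"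
proof -
  from finite_dim_Hom obtain B where B: "finite B" "span B = Hom C W W" by blast
  have v_eq: "Id C W - u = v" using uv by (simp add: algebra_simps)
  from fitting_idempotent[OF u B] obtain q w where q: "q \<in> Hom C W W" and w: "w \<in> Hom C W W"
    and qu: "q \<cdot> u = u \<cdot> q" and idem: "(u \<cdot> q) \<cdot> (u \<cdot> q) = u \<cdot> q"
    and wv: "w \<cdot> v = Id C W - u \<cdot> q"
    unfolding v_eq by metis
  from idempotent_direct_sum[OF Comp_in_Hom[OF q u] idem] obtain W1 W2 s1 r1 s2 r2 where
    1: "s1 \<in> Hom C W1 W" "r1 \<in> Hom C W W1" "r1 \<cdot> s1 = Id C W1" "s1 \<cdot> r1 = q \<cdot> u"
    and 2: "s2 \<in> Hom C W2 W" "r2 \<in> Hom C W W2" "r2 \<cdot> s2 = Id C W2" "s2 \<cdot> r2 = w \<cdot> v"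
    and sum: "is_direct_sum C W W1 W2"
    unfolding wv qu by metis
  \<comment> \<open>Splitting an idempotent that is a product \<open>a \<cdot> b\<close> makes the identity of the image factor through \<open>b\<close>.\<close>
  have absorb: "(r \<cdot> a) \<cdot> (b \<cdot> s) = Id C V"
    if s: "s \<in> Hom C V W" and r: "r \<in> Hom C W V" and rs: "r \<cdot> s = Id C V" and sr: "s \<cdot> r = a \<cdot> b"
      and a: "a \<in> Hom C W W" and b: "b \<in> Hom C W W" for V s r a b
  proof -
    have "(r \<cdot> a) \<cdot> (b \<cdot> s) = r \<cdot> (a \<cdot> (b \<cdot> s))"
      by (rule Comp_assoc[symmetric, OF Comp_in_Hom[OF s b] a r])
    also have "a \<cdot> (b \<cdot> s) = (s \<cdot> r) \<cdot> s"
      unfolding sr by (rule Comp_assoc[OF s b a])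
    also have "\<dots> = s"
      unfolding Comp_assoc[OF s r s, symmetric] rs by (rule Comp_Id_right[OF s])
    finally show ?thesis unfolding rs .
  qed
  show thesis
    by (rule that[OF 1(1) Comp_in_Hom[OF q 1(2)] absorb[OF 1 q u]
          2(1) Comp_in_Hom[OF w 2(2)] absorb[OF 2 w v] sum])
qed

lemma thick_tensor_ideal_retract:
  assumes J: "thick_tensor_ideal C J" and V: "V \<in> J"
    and "s \<in> Hom C W V" "r \<in> Hom C V W" "r \<cdot> s = Id C W"
  shows "W \<in> J"
  using assms(3-5)
proof (rule retract_complement)
  fix W' assume "is_direct_sum C V W W'"
  then show ?thesis using J V unfolding thick_tensor_ideal_def by blast
qed

end

section \<open>The largest tensor ideal with given objects\<close>

locale pseudo_tensor_category_with_commutor = pseudo_tensor_category C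
  for C :: "('k::field, 'o, 'm::ab_group_add, 'z) mon_cat_scheme" (structure) +
  fixes \<gamma> :: "'o \<Rightarrow> 'o \<Rightarrow> 'm"
  assumes commutor: "commutor C \<gamma>"
begin

lemma commutor_iso: "iso_mor C (X \<odot> Y) (Y \<odot> X) (\<gamma> X Y)"
  and commutor_natural:
    "\<lbrakk>f \<in> Hom C X X'; g \<in> Hom C Y Y'\<rbrakk> \<Longrightarrow> \<gamma> X' Y' \<cdot> (f \<otimes> g) = (g \<otimes> f) \<cdot> \<gamma> X Y"
  using commutor unfolding commutor_def by blast+

text \<open>
  Membership is tested on left multiples \<open>Z \<otimes> f\<close> alone: the commutor identifies \<open>f \<otimes> T\<close> with
  \<open>T \<otimes> f\<close>, so that this already yields a two-sided ideal.
\<close>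

definition largest_ideal :: "'o set \<Rightarrow> 'o \<Rightarrow> 'o \<Rightarrow> 'm set" where
  "largest_ideal J X Y = {f \<in> Hom C X Y. \<forall>Z W. \<forall>a \<in> Hom C W (Z \<odot> X). \<forall>b \<in> Hom C (Z \<odot> Y) W.
     b \<cdot> ((Id C Z \<otimes> f) \<cdot> a) = Id C W \<longrightarrow> W \<in> J}"

lemma largest_idealD:
  assumes "f \<in> largest_ideal J X Y"
  shows "f \<in> Hom C X Y"
    and "\<lbrakk>b \<cdot> ((Id C Z \<otimes> f) \<cdot> a) = Id C W; a \<in> Hom C W (Z \<odot> X); b \<in> Hom C (Z \<odot> Y) W\<rbrakk> \<Longrightarrow> W \<in> J"
  using assms unfolding largest_ideal_def by blast+

lemma largest_idealI:
  assumes "f \<in> Hom C X Y"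
    and "\<And>Z W a b. \<lbrakk>a \<in> Hom C W (Z \<odot> X); b \<in> Hom C (Z \<odot> Y) W;
      b \<cdot> ((Id C Z \<otimes> f) \<cdot> a) = Id C W\<rbrakk> \<Longrightarrow> W \<in> J"
  shows "f \<in> largest_ideal J X Y"
  using assms unfolding largest_ideal_def by blast

lemma largest_ideal_Comp_left:
  assumes f: "f \<in> largest_ideal J X Y" and g: "g \<in> Hom C Y Y'"
  shows "g \<cdot> f \<in> largest_ideal J X Y'"
proof -
  note fH = largest_idealD(1)[OF f]
  have "W \<in> J" if a: "a \<in> Hom C W (Z \<odot> X)" and b: "b \<in> Hom C (Z \<odot> Y') W"
    and eq: "b \<cdot> ((Id C Z \<otimes> (g \<cdot> f)) \<cdot> a) = Id C W" for Z W a b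
  proof (rule largest_idealD(2)[OF f _ a])
    note F = TensM_in_Hom[OF Id_in_Hom[of Z] fH] and G = TensM_in_Hom[OF Id_in_Hom[of Z] g]
    show "b \<cdot> (Id C Z \<otimes> g) \<in> Hom C (Z \<odot> Y) W" by (rule Comp_in_Hom[OF G b])
    have "b \<cdot> (Id C Z \<otimes> g) \<cdot> ((Id C Z \<otimes> f) \<cdot> a) = b \<cdot> ((Id C Z \<otimes> g) \<cdot> ((Id C Z \<otimes> f) \<cdot> a))"
      by (rule Comp_assoc[symmetric, OF Comp_in_Hom[OF a F] G b])
    also have "\<dots> = b \<cdot> ((Id C Z \<otimes> (g \<cdot> f)) \<cdot> a)"
      unfolding TensM_Comp_Id_left[OF fH g] Comp_assoc[OF a F G] ..
    finally show "b \<cdot> (Id C Z \<otimes> g) \<cdot> ((Id C Z \<otimes> f) \<cdot> a) = Id C W" using eq by simp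
  qed
  with Comp_in_Hom[OF fH g] show ?thesis by (rule largest_idealI)
qed

lemma largest_ideal_Comp_right:
  assumes f: "f \<in> largest_ideal J X Y" and g: "g \<in> Hom C X' X"
  shows "f \<cdot> g \<in> largest_ideal J X' Y"
proof -
  note fH = largest_idealD(1)[OF f]
  have "W \<in> J" if a: "a \<in> Hom C W (Z \<odot> X')" and b: "b \<in> Hom C (Z \<odot> Y) W"
    and eq: "b \<cdot> ((Id C Z \<otimes> (f \<cdot> g)) \<cdot> a) = Id C W" for Z W a b
  proof (rule largest_idealD(2)[OF f _ _ b])
    note F = TensM_in_Hom[OF Id_in_Hom[of Z] fH] and G = TensM_in_Hom[OF Id_in_Hom[of Z] g]
    show "(Id C Z \<otimes> g) \<cdot> a \<in> Hom C W (Z \<odot> X)" by (rule Comp_in_Hom[OF a G])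
    show "b \<cdot> ((Id C Z \<otimes> f) \<cdot> ((Id C Z \<otimes> g) \<cdot> a)) = Id C W"
      unfolding Comp_assoc[OF a G F] TensM_Comp_Id_left[OF g fH, symmetric] by (rule eq)
  qed
  with Comp_in_Hom[OF g fH] show ?thesis by (rule largest_idealI)
qed

lemma largest_ideal_Id_TensM:
  assumes f: "f \<in> largest_ideal J X Y"
  shows "Id C T \<otimes> f \<in> largest_ideal J (T \<odot> X) (T \<odot> Y)"
proof -
  note fH = largest_idealD(1)[OF f]
  have "W \<in> J" if a: "a \<in> Hom C W (Z \<odot> (T \<odot> X))" and b: "b \<in> Hom C (Z \<odot> (T \<odot> Y)) W"
    and eq: "b \<cdot> ((Id C Z \<otimes> (Id C T \<otimes> f)) \<cdot> a) = Id C W" for Z W a b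
  proof -
    obtain \<alpha> where \<alpha>: "Assoc C Z T X \<in> Hom C ((Z \<odot> T) \<odot> X) (Z \<odot> (T \<odot> X))"
      "\<alpha> \<in> Hom C (Z \<odot> (T \<odot> X)) ((Z \<odot> T) \<odot> X)" "Assoc C Z T X \<cdot> \<alpha> = Id C (Z \<odot> (T \<odot> X))"
      by (rule iso_morE[OF Assoc_iso[of Z T X]])
    have \<beta>: "Assoc C Z T Y \<in> Hom C ((Z \<odot> T) \<odot> Y) (Z \<odot> (T \<odot> Y))"
      by (rule iso_morE[OF Assoc_iso[of Z T Y]])
    note F = TensM_in_Hom[OF Id_in_Hom[of "Z \<odot> T"] fH]
      and G = TensM_in_Hom[OF Id_in_Hom[of Z] TensM_in_Hom[OF Id_in_Hom[of T] fH]]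
    have nat: "Assoc C Z T Y \<cdot> (Id C (Z \<odot> T) \<otimes> f) = (Id C Z \<otimes> (Id C T \<otimes> f)) \<cdot> Assoc C Z T X"
      using Assoc_natural[OF Id_in_Hom[of Z] Id_in_Hom[of T] fH] by (simp add: TensM_Id)
    note a' = Comp_in_Hom[OF a \<alpha>(2)]
    have "(b \<cdot> Assoc C Z T Y) \<cdot> ((Id C (Z \<odot> T) \<otimes> f) \<cdot> (\<alpha> \<cdot> a))
        = b \<cdot> ((Assoc C Z T Y \<cdot> (Id C (Z \<odot> T) \<otimes> f)) \<cdot> (\<alpha> \<cdot> a))"
      unfolding Comp_assoc[OF a' F \<beta>, symmetric]
      by (rule Comp_assoc[symmetric, OF Comp_in_Hom[OF a' F] \<beta> b])
    also have "\<dots> = b \<cdot> ((Id C Z \<otimes> (Id C T \<otimes> f)) \<cdot> ((Assoc C Z T X \<cdot> \<alpha>) \<cdot> a))"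
      unfolding nat Comp_assoc[OF a' \<alpha>(1) G, symmetric] Comp_assoc[OF a \<alpha>(2,1)] ..
    also have "\<dots> = Id C W" unfolding \<alpha>(3) Comp_Id_left[OF a] by (rule eq)
    finally show ?thesis
      by (rule largest_idealD(2)[OF f _ a' Comp_in_Hom[OF \<beta> b]])
  qed
  with TensM_in_Hom[OF Id_in_Hom fH] show ?thesis by (rule largest_idealI)
qed

lemma largest_ideal_TensM_Id:
  assumes f: "f \<in> largest_ideal J X Y"
  shows "f \<otimes> Id C T \<in> largest_ideal J (X \<odot> T) (Y \<odot> T)"
proof -
  note fH = largest_idealD(1)[OF f]
  note F = TensM_in_Hom[OF fH Id_in_Hom[of T]]
  obtain \<gamma>' where \<gamma>': "\<gamma> Y T \<in> Hom C (Y \<odot> T) (T \<odot> Y)" "\<gamma>' \<in> Hom C (T \<odot> Y) (Y \<odot> T)"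
    "\<gamma>' \<cdot> \<gamma> Y T = Id C (Y \<odot> T)"
    by (rule iso_morE[OF commutor_iso[of Y T]])
  have \<gamma>: "\<gamma> X T \<in> Hom C (X \<odot> T) (T \<odot> X)" by (rule iso_morE[OF commutor_iso[of X T]])
  have "f \<otimes> Id C T = \<gamma>' \<cdot> ((Id C T \<otimes> f) \<cdot> \<gamma> X T)"
    unfolding commutor_natural[OF fH Id_in_Hom[of T], symmetric] Comp_assoc[OF F \<gamma>'(1,2)] \<gamma>'(3)
    by (rule Comp_Id_left[OF F, symmetric])
  also have "\<dots> \<in> largest_ideal J (X \<odot> T) (Y \<odot> T)"
    by (intro largest_ideal_Comp_left[OF _ \<gamma>'(2)] largest_ideal_Comp_right[OF _ \<gamma>]
        largest_ideal_Id_TensM f)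
  finally show ?thesis .
qed

text \<open>
  If the identity of \<open>W\<close> factors through \<open>Z \<otimes> (f + g)\<close>, it is a sum of a morphism that factors
  through \<open>Z \<otimes> f\<close> and one that factors through \<open>Z \<otimes> g\<close>. The two resulting direct summands of \<open>W\<close>
  are in \<open>J\<close>, hence \<open>W\<close> is.
\<close>

lemma subspace_largest_ideal:
  assumes J: "thick_tensor_ideal C J"
  shows "subspace (largest_ideal J X Y)"
proof (rule subspaceI)
  have "W \<in> J" if a: "a \<in> Hom C W (Z \<odot> X)" and b: "b \<in> Hom C (Z \<odot> Y) W"
    and eq: "b \<cdot> ((Id C Z \<otimes> 0) \<cdot> a) = Id C W" for Z W a b
  proof -
    have 0: "Id C Z \<otimes> 0 = 0"
      using TensM_scl_right[OF Id_in_Hom[of Z] Hom_zero[of X Y], of 0] by simp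
    then have Id0: "Id C W = 0" using eq by (simp add: Comp_zero_left[OF a] Comp_zero_right[OF b])
    have "f = 0" if "f \<in> Hom C W V" for f V
      using Comp_Id_right[OF that] Comp_zero_right[OF that] Id0 by simp
    moreover have "f = 0" if "f \<in> Hom C V W" for f V
      using Comp_Id_left[OF that] Comp_zero_left[OF that] Id0 by simp
    ultimately have "is_zero_object C W" unfolding is_zero_object_def using Hom_zero by blast
    then show "W \<in> J" using J unfolding thick_tensor_ideal_def by blast
  qed
  with Hom_zero show "0 \<in> largest_ideal J X Y" by (rule largest_idealI)
next
  fix c f assume f: "f \<in> largest_ideal J X Y"
  note fH = largest_idealD(1)[OF f]
  have "scl C c f = scl C c (Id C Y) \<cdot> f"
    by (simp add: Comp_scl_left[OF fH Id_in_Hom] Comp_Id_left[OF fH])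
  then show "scl C c f \<in> largest_ideal J X Y"
    using largest_ideal_Comp_left[OF f Hom_scl[OF Id_in_Hom]] by simp
next
  fix f g assume f: "f \<in> largest_ideal J X Y" and g: "g \<in> largest_ideal J X Y"
  note fH = largest_idealD(1)[OF f] and gH = largest_idealD(1)[OF g]
  have "W \<in> J" if a: "a \<in> Hom C W (Z \<odot> X)" and b: "b \<in> Hom C (Z \<odot> Y) W"
    and eq: "b \<cdot> ((Id C Z \<otimes> (f + g)) \<cdot> a) = Id C W" for Z W a b
  proof -
    note F = TensM_in_Hom[OF Id_in_Hom[of Z] fH] and G = TensM_in_Hom[OF Id_in_Hom[of Z] gH]
    note Fa = Comp_in_Hom[OF a F] and Ga = Comp_in_Hom[OF a G]
    have conj: "V \<in> J" if "h \<in> largest_ideal J X Y" "r \<cdot> ((b \<cdot> ((Id C Z \<otimes> h) \<cdot> a)) \<cdot> s) = Id C V"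
      "s \<in> Hom C V W" "r \<in> Hom C W V" for V h r s
    proof (rule largest_idealD(2)[OF that(1)])
      note H = TensM_in_Hom[OF Id_in_Hom[of Z] largest_idealD(1)[OF that(1)]]
      show "a \<cdot> s \<in> Hom C V (Z \<odot> X)" "r \<cdot> b \<in> Hom C (Z \<odot> Y) V"
        using that(3,4) a b by (blast intro: Comp_in_Hom)+
      show "(r \<cdot> b) \<cdot> ((Id C Z \<otimes> h) \<cdot> (a \<cdot> s)) = Id C V"
        unfolding Comp_assoc[OF that(3) a H]
          Comp_assoc[OF Comp_in_Hom[OF that(3) Comp_in_Hom[OF a H]] b that(4), symmetric]
          Comp_assoc[OF that(3) Comp_in_Hom[OF a H] b]
        by (rule that(2))
    qed
    have "b \<cdot> ((Id C Z \<otimes> f) \<cdot> a) + b \<cdot> ((Id C Z \<otimes> g) \<cdot> a) = Id C W"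
      using eq unfolding TensM_add_right[OF Id_in_Hom fH gH] Comp_add_left[OF a F G]
        Comp_add_right[OF Fa Ga b] .
    with Comp_in_Hom[OF Fa b] Comp_in_Hom[OF Ga b] show ?thesis
    proof (rule Id_sum_direct_sum)
      fix W1 W2 s1 r1 s2 r2
      assume "is_direct_sum C W W1 W2"
        "s1 \<in> Hom C W1 W" "r1 \<in> Hom C W W1" "r1 \<cdot> ((b \<cdot> ((Id C Z \<otimes> f) \<cdot> a)) \<cdot> s1) = Id C W1"
        "s2 \<in> Hom C W2 W" "r2 \<in> Hom C W W2" "r2 \<cdot> ((b \<cdot> ((Id C Z \<otimes> g) \<cdot> a)) \<cdot> s2) = Id C W2"
      then show ?thesis
        using J conj[OF f] conj[OF g] unfolding thick_tensor_ideal_def by blast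
    qed
  qed
  with Hom_add[OF fH gH] show "f + g \<in> largest_ideal J X Y" by (rule largest_idealI)
qed

lemma tensor_ideal_largest_ideal:
  assumes "thick_tensor_ideal C J"
  shows "tensor_ideal C (largest_ideal J)"
  unfolding tensor_ideal_def
  by (intro conjI allI ballI subsetI subspace_largest_ideal[OF assms] largest_ideal_Comp_left
      largest_ideal_Comp_right largest_ideal_Id_TensM largest_ideal_TensM_Id)
    (auto dest: largest_idealD(1))

lemma largest_ideal_upper_bound:
  assumes I: "tensor_ideal C I" and "Ob C I \<subseteq> J"
  shows "I \<le> largest_ideal J"
proof (intro le_funI subsetI)
  fix X Y f assume f: "f \<in> I X Y"
  have "W \<in> J" if a: "a \<in> Hom C W (Z \<odot> X)" and b: "b \<in> Hom C (Z \<odot> Y) W"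
    and eq: "b \<cdot> ((Id C Z \<otimes> f) \<cdot> a) = Id C W" for Z W a b
  proof -
    have "b \<cdot> ((Id C Z \<otimes> f) \<cdot> a) \<in> I W W"
      by (intro tensor_ideal_Comp_left[OF I _ b] tensor_ideal_Comp_right[OF I a]
          tensor_ideal_Id_TensM[OF I f])
    then show ?thesis using eq assms(2) by (auto simp: Ob_def)
  qed
  with tensor_ideal_in_Hom[OF I f] show "f \<in> largest_ideal J X Y" by (rule largest_idealI)
qed

lemma Ob_largest_ideal:
  assumes J: "thick_tensor_ideal C J"
  shows "Ob C (largest_ideal J) = J"
proof (intro equalityI subsetI)
  fix X assume "X \<in> Ob C (largest_ideal J)"
  then have X: "Id C X \<in> largest_ideal J X X" by (simp add: Ob_def)
  obtain \<mu> where "LUnit C X \<in> Hom C (\<one> \<odot> X) X" "\<mu> \<in> Hom C X (\<one> \<odot> X)" "LUnit C X \<cdot> \<mu> = Id C X"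
    by (rule iso_morE[OF LUnit_iso[of X]])
  then show "X \<in> J"
    using largest_idealD(2)[OF X, of "LUnit C X" \<one> \<mu> X] by (simp add: TensM_Id Comp_Id_left)
next
  fix X assume X: "X \<in> J"
  have "W \<in> J" if a: "a \<in> Hom C W (Z \<odot> X)" and b: "b \<in> Hom C (Z \<odot> X) W"
    and eq: "b \<cdot> ((Id C Z \<otimes> Id C X) \<cdot> a) = Id C W" for Z W a b
  proof (rule thick_tensor_ideal_retract[OF J _ a b])
    show "Z \<odot> X \<in> J" using X J unfolding thick_tensor_ideal_def by blast
    show "b \<cdot> a = Id C W" using eq by (simp add: TensM_Id Comp_Id_left[OF a])
  qed
  with Id_in_Hom have "Id C X \<in> largest_ideal J X X" by (rule largest_idealI)
  then show "X \<in> Ob C (largest_ideal J)" by (simp add: Ob_def)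
qed

lemma max_ideal_eq_largest_ideal:
  assumes "thick_tensor_ideal C J"
  shows "max_ideal C J = largest_ideal J"
  unfolding max_ideal_def
  by (rule Greatest_equality)
    (use assms tensor_ideal_largest_ideal Ob_largest_ideal largest_ideal_upper_bound in auto)

text \<open>
  An object placed between the two factors is moved to the far left, where tensoring with it
  preserves the ideal.
\<close>

lemma tensor_ideal_insert_left_right:
  assumes I: "tensor_ideal C I" and f: "f \<in> Hom C X Y" and g: "g \<in> Hom C U V"
    and fg: "f \<otimes> g \<in> I (X \<odot> U) (Y \<odot> V)"
  shows "(Id C Z \<otimes> f) \<otimes> (Id C T \<otimes> g) \<in> I ((Z \<odot> X) \<odot> (T \<odot> U)) ((Z \<odot> Y) \<odot> (T \<odot> V))"
proof -
  note Z = Id_in_Hom[of Z] and T = Id_in_Hom[of T] and M = TensM_in_Hom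
  have "Id C T \<otimes> (f \<otimes> g) \<in> I (T \<odot> (X \<odot> U)) (T \<odot> (Y \<odot> V))"
    by (rule tensor_ideal_Id_TensM[OF I fg])
  then have "(Id C T \<otimes> f) \<otimes> g \<in> I ((T \<odot> X) \<odot> U) ((T \<odot> Y) \<odot> V)"
    using tensor_ideal_iso_cong[OF I Assoc_iso Assoc_iso M[OF M[OF T f] g] M[OF T M[OF f g]]
        Assoc_natural[OF T f g]] by blast
  moreover have "(\<gamma> Y T \<otimes> Id C V) \<cdot> ((f \<otimes> Id C T) \<otimes> g)
      = ((Id C T \<otimes> f) \<otimes> g) \<cdot> (\<gamma> X T \<otimes> Id C U)"
  proof -
    have \<gamma>: "\<gamma> X T \<in> Hom C (X \<odot> T) (T \<odot> X)" "\<gamma> Y T \<in> Hom C (Y \<odot> T) (T \<odot> Y)"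
      using commutor_iso by (blast elim: iso_morE)+
    show ?thesis
      unfolding TensM_Comp[OF M[OF f T] \<gamma>(2) g Id_in_Hom, symmetric]
        TensM_Comp[OF \<gamma>(1) M[OF T f] Id_in_Hom g, symmetric] commutor_natural[OF f T]
        Comp_Id_left[OF g] Comp_Id_right[OF g] ..
  qed
  ultimately have "(f \<otimes> Id C T) \<otimes> g \<in> I ((X \<odot> T) \<odot> U) ((Y \<odot> T) \<odot> V)"
    using tensor_ideal_iso_cong[OF I iso_mor_TensM[OF commutor_iso iso_mor_Id]
        iso_mor_TensM[OF commutor_iso iso_mor_Id] M[OF M[OF f T] g] M[OF M[OF T f] g]] by blast
  then have "f \<otimes> (Id C T \<otimes> g) \<in> I (X \<odot> (T \<odot> U)) (Y \<odot> (T \<odot> V))"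
    using tensor_ideal_iso_cong[OF I Assoc_iso Assoc_iso M[OF M[OF f T] g] M[OF f M[OF T g]]
        Assoc_natural[OF f T g]] by blast
  then have "Id C Z \<otimes> (f \<otimes> (Id C T \<otimes> g)) \<in> I (Z \<odot> (X \<odot> (T \<odot> U))) (Z \<odot> (Y \<odot> (T \<odot> V)))"
    by (rule tensor_ideal_Id_TensM[OF I])
  then show ?thesis
    using tensor_ideal_iso_cong[OF I Assoc_iso Assoc_iso M[OF M[OF Z f] M[OF T g]]
        M[OF Z M[OF f M[OF T g]]] Assoc_natural[OF Z f M[OF T g]]] by blast
qed

lemma prime_largest_ideal:
  assumes "prime_thick_tensor_ideal C J"
  shows "prime_tensor_ideal C (largest_ideal J)"
proof -
  have J: "thick_tensor_ideal C J" and one: "\<one> \<notin> J"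
    and prime: "\<And>X Y. X \<odot> Y \<in> J \<Longrightarrow> X \<in> J \<or> Y \<in> J"
    using assms unfolding prime_thick_tensor_ideal_def by blast+
  let ?K = "largest_ideal J"
  note K = tensor_ideal_largest_ideal[OF J]
  have "?K \<noteq> Hom C"
    using one Ob_largest_ideal[OF J] Id_in_Hom by (auto simp: Ob_def)
  moreover have "f \<in> ?K X Y \<or> g \<in> ?K U V"
    if f: "f \<in> Hom C X Y" and g: "g \<in> Hom C U V" and fg: "f \<otimes> g \<in> ?K (X \<odot> U) (Y \<odot> V)" for f g X Y U V
  proof (rule ccontr)
    assume "\<not> ?thesis"
    then obtain Z W a b T W' a' b' where
      a: "a \<in> Hom C W (Z \<odot> X)" and b: "b \<in> Hom C (Z \<odot> Y) W"
      and W: "b \<cdot> ((Id C Z \<otimes> f) \<cdot> a) = Id C W" "W \<notin> J"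
      and a': "a' \<in> Hom C W' (T \<odot> U)" and b': "b' \<in> Hom C (T \<odot> V) W'"
      and W': "b' \<cdot> ((Id C T \<otimes> g) \<cdot> a') = Id C W'" "W' \<notin> J"
      using f g unfolding largest_ideal_def by blast
    let ?F = "Id C Z \<otimes> f" and ?G = "Id C T \<otimes> g"
    note F = TensM_in_Hom[OF Id_in_Hom[of Z] f] and G = TensM_in_Hom[OF Id_in_Hom[of T] g]
    have "Id C (W \<odot> W') = (b \<cdot> (?F \<cdot> a)) \<otimes> (b' \<cdot> (?G \<cdot> a'))"
      by (simp add: W(1) W'(1) TensM_Id)
    also have "\<dots> = (b \<otimes> b') \<cdot> ((?F \<otimes> ?G) \<cdot> (a \<otimes> a'))"
      unfolding TensM_Comp[OF Comp_in_Hom[OF a F] b Comp_in_Hom[OF a' G] b']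
        TensM_Comp[OF a F a' G] ..
    also have "\<dots> \<in> ?K (W \<odot> W') (W \<odot> W')"
      by (intro tensor_ideal_Comp_left[OF K _ TensM_in_Hom[OF b b']]
          tensor_ideal_Comp_right[OF K TensM_in_Hom[OF a a']]
          tensor_ideal_insert_left_right[OF K f g fg])
    finally have "W \<odot> W' \<in> J" using Ob_largest_ideal[OF J] by (auto simp: Ob_def)
    then show False using prime W(2) W'(2) by blast
  qed
  ultimately show ?thesis using K unfolding prime_tensor_ideal_def by blast
qed

section \<open>Prime tensor ideals and nilpotency of the radical\<close>

lemma radical_comp_in_Hom: "radical_comp C n X Y f \<Longrightarrow> f \<in> Hom C X Y"
  by (induction rule: radical_comp.induct) (auto simp: Id_in_Hom radical_def intro: Comp_in_Hom)

text \<open>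
  The idempotent \<open>e\<close> projects onto a largest direct summand of \<open>A\<close> whose identity is in \<open>I\<close>. The
  endomorphisms \<open>u = g \<cdot> (h - h \<cdot> e)\<close> are in the largest ideal, and the Fitting idempotent of such
  a \<open>u\<close> has its image in \<open>Ob C I\<close>. It can be made orthogonal to \<open>e\<close>, so by the choice of \<open>e\<close> it
  vanishes, which means that \<open>Id - u\<close> is invertible.
\<close>

lemma largest_ideal_radical_decomp:
  assumes I: "tensor_ideal C I" and h: "h \<in> largest_ideal (Ob C I) A B"
  obtains e where "e \<in> I A A" "h - h \<cdot> e \<in> radical C A B"
proof -
  let ?K = "largest_ideal (Ob C I)"
  note J = thick_tensor_ideal_Ob[OF I]
  note K = tensor_ideal_largest_ideal[OF J]
  note hH = largest_idealD(1)[OF h]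
  note sub = tensor_ideal_subspace[OF I] and IH = tensor_ideal_in_Hom[OF I]
  from finite_dim_Hom obtain G where G: "finite G" "span G = Hom C A A" by blast
  \<comment> \<open>A larger image of \<open>e\<close> means a smaller right annihilator, whose dimension is to be minimised.\<close>
  define N where "N e = {x \<in> Hom C A A. e \<cdot> x = 0}" for e
  define P where "P e \<longleftrightarrow> e \<in> I A A \<and> e \<cdot> e = e" for e
  have "P 0" using subspace_0[OF sub] by (simp add: P_def Comp_zero_left[OF Hom_zero])
  then obtain e where e: "P e" and least: "\<And>e'. P e' \<Longrightarrow> dim (N e) \<le> dim (N e')"
    using ex_has_least_nat[of P 0 "\<lambda>e. dim (N e)"] by blast
  have eI: "e \<in> I A A" and ee: "e \<cdot> e = e" using e by (auto simp: P_def)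
  note eH = IH[OF eI]
  define k where "k = h - h \<cdot> e"
  have heH: "h \<cdot> e \<in> Hom C A B" by (rule Comp_in_Hom[OF eH hH])
  have kH: "k \<in> Hom C A B" unfolding k_def by (rule Hom_diff[OF hH heH])
  have kK: "k \<in> ?K A B"
    unfolding k_def by (rule subspace_diff[OF tensor_ideal_subspace[OF K] h largest_ideal_Comp_right[OF h eH]])
  have ke: "k \<cdot> e = 0"
    unfolding k_def Comp_diff_left[OF eH hH heH] Comp_assoc[OF eH eH hH, symmetric] ee by simp
  have "iso_mor C A A (Id C A - g \<cdot> k)" if g: "g \<in> Hom C B A" for g
  proof -
    define u where "u = g \<cdot> k"
    have u: "u \<in> Hom C A A" unfolding u_def by (rule Comp_in_Hom[OF kH g])
    have uK: "u \<in> ?K A A" unfolding u_def by (rule largest_ideal_Comp_left[OF kK g])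
    have ue: "u \<cdot> e = 0"
      unfolding u_def Comp_assoc[OF eH kH g, symmetric] ke by (rule Comp_zero_right[OF g])
    from fitting_idempotent[OF u G] obtain q w where q: "q \<in> Hom C A A" and w: "w \<in> Hom C A A"
      and qu: "q \<cdot> u = u \<cdot> q" and idem: "(u \<cdot> q) \<cdot> (u \<cdot> q) = u \<cdot> q"
      and inv: "w \<cdot> (Id C A - u) = Id C A - u \<cdot> q" "(Id C A - u) \<cdot> w = Id C A - u \<cdot> q" by metis
    define p where "p = u \<cdot> q"
    have pH: "p \<in> Hom C A A" unfolding p_def by (rule Comp_in_Hom[OF q u])
    have pp: "p \<cdot> p = p" using idem unfolding p_def .
    have pK: "p \<in> ?K A A" unfolding p_def by (rule largest_ideal_Comp_right[OF uK q])
    have pe: "p \<cdot> e = 0"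
      unfolding p_def qu[symmetric] Comp_assoc[OF eH u q, symmetric] ue by (rule Comp_zero_right[OF q])
    have pI: "p \<in> I A A"
    proof -
      from idempotent_complete[OF pH pp] obtain D r s where
        D: "r \<in> Hom C A D" "s \<in> Hom C D A" "r \<cdot> s = Id C D" "s \<cdot> r = p" by blast
      have "Id C D = r \<cdot> (p \<cdot> s)"
        unfolding D(4)[symmetric] Comp_assoc[OF D(2,1,2), symmetric] D(3) Comp_Id_right[OF D(2)]
        by (rule refl)
      also have "\<dots> \<in> ?K D D"
        by (rule largest_ideal_Comp_left[OF largest_ideal_Comp_right[OF pK D(2)] D(1)])
      finally have "D \<in> Ob C I" using Ob_largest_ideal[OF J] by (auto simp: Ob_def)
      then have "s \<in> I D A" using D(2) by (simp add: tensor_ideal_Ob_iff[OF I])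
      then show ?thesis unfolding D(4)[symmetric] by (rule tensor_ideal_Comp_right[OF I D(1)])
    qed
    \<comment> \<open>While \<open>p \<cdot> e = 0\<close>, the product \<open>e \<cdot> p\<close> need not vanish; \<open>p'\<close> is the orthogonal replacement of \<open>p\<close>.\<close>
    define p' where "p' = p - e \<cdot> p"
    have ep: "e \<cdot> p \<in> Hom C A A" by (rule Comp_in_Hom[OF pH eH])
    have p'H: "p' \<in> Hom C A A" unfolding p'_def by (rule Hom_diff[OF pH ep])
    have ep': "e \<cdot> p' = 0"
      unfolding p'_def Comp_diff_right[OF pH ep eH] Comp_assoc[OF pH eH eH] ee by simp
    have p'e: "p' \<cdot> e = 0"
      unfolding p'_def Comp_diff_left[OF eH pH ep] Comp_assoc[OF eH pH eH, symmetric] pe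
      by (simp add: Comp_zero_right[OF eH])
    have pp': "p \<cdot> p' = p"
      unfolding p'_def Comp_diff_right[OF pH ep pH] Comp_assoc[OF pH eH pH] pe pp
      by (simp add: Comp_zero_left[OF pH])
    have p'p': "p' \<cdot> p' = p'"
    proof -
      have "p' \<cdot> p' = p \<cdot> p' - e \<cdot> (p \<cdot> p')"
        unfolding Comp_assoc[OF p'H pH eH] Comp_diff_left[OF p'H pH ep, symmetric]
        by (simp add: p'_def)
      also have "\<dots> = p'" unfolding pp' by (simp only: p'_def)
      finally show ?thesis .
    qed
    define e' where "e' = e + p'"
    have e'H: "e' \<in> Hom C A A" unfolding e'_def by (rule Hom_add[OF eH p'H])
    have "e' \<cdot> e' = e'"
      unfolding e'_def Comp_add_left[OF e'H[unfolded e'_def] eH p'H]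
        Comp_add_right[OF eH p'H eH] Comp_add_right[OF eH p'H p'H]
      by (simp add: ee ep' p'e p'p')
    moreover have "e' \<in> I A A"
      unfolding e'_def p'_def
      by (intro subspace_add[OF sub] subspace_diff[OF sub] eI pI tensor_ideal_Comp_left[OF I pI eH])
    ultimately have "P e'" by (simp add: P_def)
    have "p' = 0"
    proof (rule ccontr)
      assume "p' \<noteq> 0"
      have e'p': "e' \<cdot> p' = p'"
        unfolding e'_def Comp_add_left[OF p'H eH p'H] ep' p'p' by simp
      have "N e' \<subseteq> N e"
      proof
        fix x assume "x \<in> N e'"
        then have x: "x \<in> Hom C A A" "e' \<cdot> x = 0" by (auto simp: N_def)
        have "e \<cdot> e' = e" unfolding e'_def Comp_add_right[OF eH p'H eH] by (simp add: ee ep')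
        then have "e \<cdot> x = 0"
          using Comp_assoc[OF x(1) e'H eH] x(2) by (simp add: Comp_zero_right[OF eH])
        then show "x \<in> N e" using x by (simp add: N_def)
      qed
      moreover have "p' \<in> N e" "p' \<notin> N e'" using p'H ep' e'p' \<open>p' \<noteq> 0\<close> by (auto simp: N_def)
      ultimately have "N e' \<subset> N e" by blast
      moreover have "subspace (N e')"
        by (rule subspaceI) (auto simp: N_def Hom_zero Hom_add Hom_scl Comp_zero_right[OF e'H]
            Comp_add_right[OF _ _ e'H] Comp_scl_right[OF _ e'H])
      ultimately have "dim (N e') < dim (N e)"
        by (intro dim_strict_mono[OF G(1)]) (auto simp: G N_def)
      then show False using least[OF \<open>P e'\<close>] by simp
    qed
    then have "p = 0" using pp' by (simp add: Comp_zero_right[OF pH])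
    then show ?thesis
      using inv by (intro iso_morI[OF _ w]) (auto simp: u_def[symmetric] p_def intro: Hom_diff Id_in_Hom u)
  qed
  then have "k \<in> radical C A B" using kH by (simp add: radical_def)
  with eI show thesis unfolding k_def by (rule that)
qed

text \<open>
  Composites of \<open>n\<close> morphisms of an ideal. In contrast to the corresponding composites of radical
  morphisms these are stable under tensoring with an object, which is why the tensor powers below
  are first written as chains in the largest ideal and only then compared with the radical.
\<close>

inductive mor_chain :: "('o \<Rightarrow> 'o \<Rightarrow> 'm set) \<Rightarrow> nat \<Rightarrow> 'o \<Rightarrow> 'o \<Rightarrow> 'm \<Rightarrow> bool" for K where
  Nil: "mor_chain K 0 X X (Id C X)"
| Cons: "\<lbrakk>mor_chain K n X Y f; g \<in> K Y Z\<rbrakk> \<Longrightarrow> mor_chain K (Suc n) X Z (g \<cdot> f)"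

lemma mor_chain_in_Hom:
  assumes "tensor_ideal C K" "mor_chain K n X Y f"
  shows "f \<in> Hom C X Y"
  using assms(2) by (induction rule: mor_chain.induct)
    (auto intro: Id_in_Hom Comp_in_Hom tensor_ideal_in_Hom[OF assms(1)])

lemma mor_chain_Id_TensM:
  assumes "tensor_ideal C K" "mor_chain K n X Y f"
  shows "mor_chain K n (T \<odot> X) (T \<odot> Y) (Id C T \<otimes> f)"
  using assms(2)
proof (induction rule: mor_chain.induct)
  case (Nil X)
  show ?case unfolding TensM_Id by (rule mor_chain.Nil)
next
  case (Cons n X Y f g Z)
  show ?case
    unfolding TensM_Comp_Id_left[OF mor_chain_in_Hom[OF assms(1) Cons(1)] tensor_ideal_in_Hom[OF assms(1) Cons(2)]]
    by (rule mor_chain.Cons[OF Cons.IH tensor_ideal_Id_TensM[OF assms(1) Cons(2)]])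
qed

lemma mor_chain_largest_ideal:
  assumes I: "tensor_ideal C I" and "mor_chain (largest_ideal (Ob C I)) n X Y f"
  shows "\<exists>fs. (\<forall>s \<in> set fs. radical_comp C n X Y s) \<and> f - sum_list fs \<in> I X Y"
  using assms(2)
proof (induction rule: mor_chain.induct)
  case (Nil X)
  have "radical_comp C 0 X X (Id C X)" by (rule radical_comp.Nil)
  then show ?case
    using subspace_0[OF tensor_ideal_subspace[OF I]] by (intro exI[of _ "[Id C X]"]) simp
next
  case (Cons n X Y f g Z)
  note fH = mor_chain_in_Hom[OF tensor_ideal_largest_ideal[OF thick_tensor_ideal_Ob[OF I]] Cons(1)]
  note gH = largest_idealD(1)[OF Cons(2)]
  from Cons.IH obtain fs where fs: "\<forall>s \<in> set fs. radical_comp C n X Y s" "f - sum_list fs \<in> I X Y"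
    by blast
  from largest_ideal_radical_decomp[OF I Cons(2)] obtain e where
    e: "e \<in> I Y Y" "g - g \<cdot> e \<in> radical C Y Z" .
  define r where "r = g - g \<cdot> e"
  note eH = tensor_ideal_in_Hom[OF I e(1)]
  have geH: "g \<cdot> e \<in> Hom C Y Z" by (rule Comp_in_Hom[OF eH gH])
  have rH: "r \<in> Hom C Y Z" unfolding r_def by (rule Hom_diff[OF gH geH])
  have "\<forall>s \<in> set fs. s \<in> Hom C X Y" using fs(1) radical_comp_in_Hom by blast
  from Comp_sum_list_right[OF rH this] have sH: "sum_list fs \<in> Hom C X Y"
    and rs: "r \<cdot> sum_list fs = sum_list (map ((\<cdot>) r) fs)" by simp_all
  have "g \<cdot> f - r \<cdot> sum_list fs = g \<cdot> (f - sum_list fs) + (g \<cdot> e) \<cdot> sum_list fs"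
    unfolding r_def Comp_diff_left[OF sH gH geH] Comp_diff_right[OF fH sH gH] by simp
  also have "\<dots> \<in> I X Z"
    by (intro subspace_add[OF tensor_ideal_subspace[OF I]] tensor_ideal_Comp_left[OF I fs(2) gH]
        tensor_ideal_Comp_right[OF I sH] tensor_ideal_Comp_left[OF I e(1) gH])
  finally have "g \<cdot> f - sum_list (map ((\<cdot>) r) fs) \<in> I X Z" unfolding rs .
  moreover have "\<forall>s \<in> set (map ((\<cdot>) r) fs). radical_comp C (Suc n) X Z s"
    using fs(1) e(2) by (auto simp: r_def intro: radical_comp.Cons)
  ultimately show ?case by blast
qed

text \<open>The index counts the factors beyond the first one, which avoids the unitors.\<close>

primrec tensor_power_obj :: "'o \<Rightarrow> nat \<Rightarrow> 'o" where
  "tensor_power_obj X 0 = X"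
| "tensor_power_obj X (Suc n) = X \<odot> tensor_power_obj X n"

primrec tensor_power :: "'m \<Rightarrow> nat \<Rightarrow> 'm" where
  "tensor_power f 0 = f"
| "tensor_power f (Suc n) = f \<otimes> tensor_power f n"

lemma tensor_power_in_Hom:
  "f \<in> Hom C X Y \<Longrightarrow> tensor_power f n \<in> Hom C (tensor_power_obj X n) (tensor_power_obj Y n)"
  by (induction n) (auto intro: TensM_in_Hom)

text \<open>Each factor \<open>f\<close> acts in its own tensor slot, and the slots can be treated one after the other.\<close>

lemma mor_chain_tensor_power:
  assumes K: "tensor_ideal C K" and f: "f \<in> K X Y"
  shows "mor_chain K (Suc n) (tensor_power_obj X n) (tensor_power_obj Y n) (tensor_power f n)"
proof (induction n)
  case 0
  show ?case
    using mor_chain.Cons[of K 0, OF mor_chain.Nil, of f X Y] f Comp_Id_right[OF tensor_ideal_in_Hom[OF K f]] by simp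
next
  case (Suc n)
  note fH = tensor_ideal_in_Hom[OF K f]
  show ?case
    unfolding tensor_power.simps tensor_power_obj.simps TensM_factor[OF fH tensor_power_in_Hom[OF fH]]
    by (rule mor_chain.Cons[OF mor_chain_Id_TensM[OF K Suc] tensor_ideal_TensM_Id[OF K f]])
qed

lemma prime_tensor_ideal_tensor_power:
  assumes "prime_tensor_ideal C I" "f \<in> Hom C X Y"
    and "tensor_power f n \<in> I (tensor_power_obj X n) (tensor_power_obj Y n)"
  shows "f \<in> I X Y"
  using assms(3)
proof (induction n)
  case (Suc n)
  then show ?case
    using assms(1,2) tensor_power_in_Hom[OF assms(2), of n]
    unfolding prime_tensor_ideal_def tensor_power.simps tensor_power_obj.simps by blast
qed simp

lemma prime_tensor_ideal_eq_largest_ideal: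
  assumes nilpotent: "\<And>X Y. radical_power C M X Y = {0}" and prime: "prime_tensor_ideal C I"
  shows "largest_ideal (Ob C I) = I"
proof (rule antisym)
  have I: "tensor_ideal C I" using prime by (simp add: prime_tensor_ideal_def)
  let ?K = "largest_ideal (Ob C I)"
  note K = tensor_ideal_largest_ideal[OF thick_tensor_ideal_Ob[OF I]]
  show "I \<le> ?K" by (rule largest_ideal_upper_bound[OF I order_refl])
  have chain: "f \<in> I X Y" if "mor_chain ?K M X Y f" for X Y f
  proof -
    from mor_chain_largest_ideal[OF I that] obtain fs where
      fs: "\<forall>s \<in> set fs. radical_comp C M X Y s" "f - sum_list fs \<in> I X Y" by blast
    from fs(1) have "sum_list fs \<in> radical_power C M X Y" unfolding radical_power_def by blast
    then show ?thesis using fs(2) by (simp add: nilpotent)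
  qed
  show "?K \<le> I"
  proof (intro le_funI subsetI)
    fix X Y f assume f: "f \<in> ?K X Y"
    have "tensor_power f M \<in> I (tensor_power_obj X M) (tensor_power_obj Y M)"
      using mor_chain_tensor_power[OF K f, of M]
    proof (cases rule: mor_chain.cases)
      case (Cons Z g h)
      show ?thesis
        unfolding Cons(1)
        by (rule tensor_ideal_Comp_left[OF I chain[OF Cons(2)] tensor_ideal_in_Hom[OF K Cons(3)]])
    qed
    then show "f \<in> I X Y"
      by (rule prime_tensor_ideal_tensor_power[OF prime tensor_ideal_in_Hom[OF K f]])
  qed
qed

section \<open>Linear dependence modulo a prime tensor ideal\<close>

text \<open>
  If \<open>p\<close> is a nonzero polynomial of least degree with \<open>p(u)\<close> in \<open>I\<close>, and \<open>p = (x - c) q\<close>, then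
  \<open>q(u)\<close> is an eigenvector for \<open>c\<close> of left multiplication by \<open>u\<close> on the endomorphisms modulo \<open>I\<close>.
\<close>

lemma eigenvector_mod_tensor_ideal:
  assumes closed: "\<And>p :: 'k poly. degree p > 0 \<Longrightarrow> \<exists>x. poly p x = 0"
    and I: "tensor_ideal C I" and W: "W \<notin> Ob C I" and u: "u \<in> Hom C W W"
  obtains n c where "n \<in> Hom C W W" "n \<notin> I W W" "u \<cdot> n - scl C c n \<in> I W W"
proof -
  note sub = tensor_ideal_subspace[OF I]
  define P where "P p \<longleftrightarrow> p \<noteq> 0 \<and> poly_end W u p \<in> I W W" for p
  from finite_dim_Hom obtain B where "finite B" "span B = Hom C W W" by blast
  then obtain p0 where "P p0"
    using ex_annihilating_poly[OF u] subspace_0[OF sub] unfolding P_def by metis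
  then obtain p where p: "P p" and least: "\<And>q. P q \<Longrightarrow> degree p \<le> degree q"
    using ex_has_least_nat[of P p0 degree] by blast
  have "degree p > 0"
  proof (rule ccontr)
    assume "\<not> degree p > 0"
    then obtain a where a: "p = [:a:]" by (metis degree_eq_zeroE neq0_conv)
    then have "a \<noteq> 0" "scl C a (Id C W) \<in> I W W" using p by (auto simp: P_def poly_end_const[OF u])
    then have "scl C (inverse a * a) (Id C W) \<in> I W W"
      using subspace_scale[OF sub, of "scl C a (Id C W)" W W "inverse a"] by simp
    then show False using W \<open>a \<noteq> 0\<close> by (simp add: Ob_def)
  qed
  then obtain c where "poly p c = 0" using closed by blast
  then obtain q where q: "p = [:-c, 1:] * q" by (auto simp: poly_eq_0_iff_dvd)
  have "q \<noteq> 0" using p q by (auto simp: P_def)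
  then have "degree p = Suc (degree q)" unfolding q by (subst degree_mult_eq) auto
  then have "\<not> P q" using least[of q] by auto
  define n where "n = poly_end W u q"
  have nH: "n \<in> Hom C W W" unfolding n_def by (rule poly_end_in_Hom[OF u])
  have "poly_end W u p = u \<cdot> n - scl C c n"
  proof -
    have "poly_end W u p = (u - scl C c (Id C W)) \<cdot> n"
      unfolding q poly_end_mult[OF u] by (simp add: poly_end_linear[OF u] n_def)
    then show ?thesis
      by (simp add: Comp_diff_left[OF nH u Hom_scl[OF Id_in_Hom]] Comp_scl_left[OF nH Id_in_Hom]
          Comp_Id_left[OF nH])
  qed
  with p have "u \<cdot> n - scl C c n \<in> I W W" by (simp add: P_def)
  moreover have "n \<notin> I W W" using \<open>\<not> P q\<close> \<open>q \<noteq> 0\<close> by (simp add: P_def n_def)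
  ultimately show thesis using nH by (intro that)
qed

text \<open>
  The map \<open>f \<mapsto> b \<cdot> (Z \<otimes> f) \<cdot> a\<close> on the first factors extends to a linear map that preserves \<open>I\<close>
  on the morphisms \<open>X \<odot> U \<rightarrow> Y \<odot> V\<close>: conjugate by associators, tensor with \<open>Z\<close> and compose.
\<close>

lemma TensM_sandwich_mem:
  assumes I: "tensor_ideal C I" and a: "a \<in> Hom C W (Z \<odot> X)" and b: "b \<in> Hom C (Z \<odot> Y) W"
    and g: "g \<in> Hom C U V" "h \<in> Hom C X Y"
    and A: "\<And>i. i \<in> A \<Longrightarrow> hs i \<in> Hom C X Y" "\<And>i. i \<in> A \<Longrightarrow> gs i \<in> Hom C U V"
    and mem: "h \<otimes> g + (\<Sum>i\<in>A. hs i \<otimes> gs i) \<in> I (X \<odot> U) (Y \<odot> V)"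
  shows "(b \<cdot> ((Id C Z \<otimes> h) \<cdot> a)) \<otimes> g + (\<Sum>i\<in>A. (b \<cdot> ((Id C Z \<otimes> hs i) \<cdot> a)) \<otimes> gs i)
    \<in> I (W \<odot> U) (W \<odot> V)"
proof -
  obtain \<alpha> where \<alpha>: "Assoc C Z Y V \<in> Hom C ((Z \<odot> Y) \<odot> V) (Z \<odot> (Y \<odot> V))"
    "\<alpha> \<in> Hom C (Z \<odot> (Y \<odot> V)) ((Z \<odot> Y) \<odot> V)" "\<alpha> \<cdot> Assoc C Z Y V = Id C ((Z \<odot> Y) \<odot> V)"
    by (rule iso_morE[OF Assoc_iso[of Z Y V]])
  have \<beta>: "Assoc C Z X U \<in> Hom C ((Z \<odot> X) \<odot> U) (Z \<odot> (X \<odot> U))"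
    by (rule iso_morE[OF Assoc_iso[of Z X U]])
  define L where "L = (b \<otimes> Id C V) \<cdot> \<alpha>"
  define R where "R = Assoc C Z X U \<cdot> (a \<otimes> Id C U)"
  have bV: "b \<otimes> Id C V \<in> Hom C ((Z \<odot> Y) \<odot> V) (W \<odot> V)" by (rule TensM_in_Hom[OF b Id_in_Hom])
  have aU: "a \<otimes> Id C U \<in> Hom C (W \<odot> U) ((Z \<odot> X) \<odot> U)" by (rule TensM_in_Hom[OF a Id_in_Hom])
  have L: "L \<in> Hom C (Z \<odot> (Y \<odot> V)) (W \<odot> V)" unfolding L_def by (rule Comp_in_Hom[OF \<alpha>(2) bV])
  have R: "R \<in> Hom C (W \<odot> U) (Z \<odot> (X \<odot> U))" unfolding R_def by (rule Comp_in_Hom[OF aU \<beta>])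
  define \<Psi> where "\<Psi> t = L \<cdot> ((Id C Z \<otimes> t) \<cdot> R)" for t
  have \<Psi>_TensM: "\<Psi> (f \<otimes> k) = (b \<cdot> ((Id C Z \<otimes> f) \<cdot> a)) \<otimes> k"
    if f: "f \<in> Hom C X Y" and k: "k \<in> Hom C U V" for f k
  proof -
    note F = TensM_in_Hom[OF Id_in_Hom[of Z] f]
    note Fk = TensM_in_Hom[OF F k] and fk = TensM_in_Hom[OF Id_in_Hom[of Z] TensM_in_Hom[OF f k]]
    have "(b \<cdot> ((Id C Z \<otimes> f) \<cdot> a)) \<otimes> k = (b \<cdot> ((Id C Z \<otimes> f) \<cdot> a)) \<otimes> (Id C V \<cdot> (k \<cdot> Id C U))"
      by (simp add: Comp_Id_left[OF k] Comp_Id_right[OF k])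
    also have "\<dots> = (b \<otimes> Id C V) \<cdot> (((Id C Z \<otimes> f) \<otimes> k) \<cdot> (a \<otimes> Id C U))"
      unfolding TensM_Comp[OF Comp_in_Hom[OF a F] b Comp_in_Hom[OF Id_in_Hom k] Id_in_Hom]
        TensM_Comp[OF a F Id_in_Hom k] ..
    also have "(Id C Z \<otimes> f) \<otimes> k = \<alpha> \<cdot> (Assoc C Z Y V \<cdot> ((Id C Z \<otimes> f) \<otimes> k))"
      unfolding Comp_assoc[OF Fk \<alpha>(1,2)] \<alpha>(3) by (rule Comp_Id_left[OF Fk, symmetric])
    also have "\<dots> = \<alpha> \<cdot> ((Id C Z \<otimes> (f \<otimes> k)) \<cdot> Assoc C Z X U)"
      unfolding Assoc_natural[OF Id_in_Hom f k] ..
    also have "(b \<otimes> Id C V) \<cdot> (\<alpha> \<cdot> ((Id C Z \<otimes> (f \<otimes> k)) \<cdot> Assoc C Z X U) \<cdot> (a \<otimes> Id C U)) = \<Psi> (f \<otimes> k)"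
      unfolding \<Psi>_def L_def R_def
        Comp_assoc[OF aU Comp_in_Hom[OF \<beta> fk] \<alpha>(2), symmetric] Comp_assoc[OF aU \<beta> fk]
      by (rule Comp_assoc[OF Comp_in_Hom[OF aU Comp_in_Hom[OF \<beta> fk]] \<alpha>(2) bV])
    finally show ?thesis ..
  qed
  have \<Psi>_add: "\<Psi> (s + t) = \<Psi> s + \<Psi> t"
    if s: "s \<in> Hom C (X \<odot> U) (Y \<odot> V)" and t: "t \<in> Hom C (X \<odot> U) (Y \<odot> V)" for s t
  proof -
    note S = TensM_in_Hom[OF Id_in_Hom[of Z] s] and T = TensM_in_Hom[OF Id_in_Hom[of Z] t]
    show ?thesis
      unfolding \<Psi>_def TensM_add_right[OF Id_in_Hom s t] Comp_add_left[OF R S T]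
        Comp_add_right[OF Comp_in_Hom[OF R S] Comp_in_Hom[OF R T] L] ..
  qed
  have "\<Psi> 0 = 0" using \<Psi>_add[OF Hom_zero Hom_zero] by simp
  then have "\<Psi> (\<Sum>i\<in>A. hs i \<otimes> gs i) = (\<Sum>i\<in>A. \<Psi> (hs i \<otimes> gs i))"
    using A by (induction A rule: infinite_finite_induct) (auto simp: \<Psi>_add TensM_in_Hom Hom_sum)
  then have "\<Psi> (h \<otimes> g + (\<Sum>i\<in>A. hs i \<otimes> gs i))
      = (b \<cdot> ((Id C Z \<otimes> h) \<cdot> a)) \<otimes> g + (\<Sum>i\<in>A. (b \<cdot> ((Id C Z \<otimes> hs i) \<cdot> a)) \<otimes> gs i)"
    using g A by (simp add: \<Psi>_add TensM_in_Hom Hom_sum \<Psi>_TensM)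
  moreover have "\<Psi> (h \<otimes> g + (\<Sum>i\<in>A. hs i \<otimes> gs i)) \<in> I (W \<odot> U) (W \<odot> V)"
    unfolding \<Psi>_def
    by (rule tensor_ideal_Comp_left[OF I tensor_ideal_Comp_right[OF I R tensor_ideal_Id_TensM[OF I mem]] L])
  ultimately show ?thesis by simp
qed

text \<open>
  A morphism \<open>h\<close> outside the largest ideal can be turned into the identity of some \<open>W\<close> outside
  \<open>Ob C I\<close>, which makes the other first factors endomorphisms of \<open>W\<close>. Composition with an eigenvector
  \<open>n\<close> of \<open>u (hs k)\<close> modulo \<open>I\<close> leaves \<open>n \<otimes> (g + c g\<^sub>k)\<close> plus the remaining summands, and \<open>n\<close> takes
  over the part of \<open>h\<close>. With no summands left, the claim is the primality of \<open>I\<close>.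
\<close>

lemma dependence_mod_prime_tensor_ideal:
  assumes closed: "\<And>p :: 'k poly. degree p > 0 \<Longrightarrow> \<exists>x. poly p x = 0"
    and prime: "prime_tensor_ideal C I" and max: "largest_ideal (Ob C I) = I"
    and "finite A" "h \<in> Hom C X Y" "h \<notin> I X Y" "g \<in> Hom C U V"
    and "\<And>i. i \<in> A \<Longrightarrow> hs i \<in> Hom C X Y" "\<And>i. i \<in> A \<Longrightarrow> gs i \<in> Hom C U V"
    and "h \<otimes> g + (\<Sum>i\<in>A. hs i \<otimes> gs i) \<in> I (X \<odot> U) (Y \<odot> V)"
  shows "\<exists>c. g + (\<Sum>i\<in>A. scl C (c i) (gs i)) \<in> I U V"
  using assms(4-)
proof (induction A arbitrary: X Y h g hs rule: finite_induct)
  case empty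
  then have "h \<otimes> g \<in> I (X \<odot> U) (Y \<odot> V)" by simp
  then have "g \<in> I U V" using prime empty.prems(1-3) unfolding prime_tensor_ideal_def by blast
  then show ?case by simp
next
  case (insert k A)
  have I: "tensor_ideal C I" using prime by (simp add: prime_tensor_ideal_def)
  note sub = tensor_ideal_subspace[OF I]
  have "h \<notin> largest_ideal (Ob C I) X Y" using insert.prems(2) by (simp add: max)
  then obtain Z W a b where a: "a \<in> Hom C W (Z \<odot> X)" and b: "b \<in> Hom C (Z \<odot> Y) W"
    and bha: "b \<cdot> ((Id C Z \<otimes> h) \<cdot> a) = Id C W" and W: "W \<notin> Ob C I"
    using insert.prems(1) unfolding largest_ideal_def by blast
  define u where "u f = b \<cdot> ((Id C Z \<otimes> f) \<cdot> a)" for f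
  have u: "u f \<in> Hom C W W" if "f \<in> Hom C X Y" for f
    unfolding u_def by (intro Comp_in_Hom[OF _ b] Comp_in_Hom[OF a] TensM_in_Hom[OF Id_in_Hom that])
  have hk: "hs k \<in> Hom C X Y" and gk: "gs k \<in> Hom C U V" using insert.prems by auto
  from eigenvector_mod_tensor_ideal[OF closed I W u[OF hk]] obtain n c where
    n: "n \<in> Hom C W W" "n \<notin> I W W" and eig: "u (hs k) \<cdot> n - scl C c n \<in> I W W" by blast
  have un: "b \<cdot> ((Id C Z \<otimes> f) \<cdot> (a \<cdot> n)) = u f \<cdot> n" if f: "f \<in> Hom C X Y" for f
  proof -
    note F = TensM_in_Hom[OF Id_in_Hom[of Z] f]
    show ?thesis
      unfolding u_def Comp_assoc[OF n(1) a F] by (rule Comp_assoc[OF n(1) Comp_in_Hom[OF a F] b])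
  qed
  have unH: "u f \<cdot> n \<in> Hom C W W" if "f \<in> Hom C X Y" for f
    by (rule Comp_in_Hom[OF n(1) u[OF that]])
  let ?S = "\<Sum>i\<in>A. (u (hs i) \<cdot> n) \<otimes> gs i"
  have eq: "(\<Sum>i\<in>insert k A. (b \<cdot> ((Id C Z \<otimes> hs i) \<cdot> (a \<cdot> n))) \<otimes> gs i)
      = (\<Sum>i\<in>insert k A. (u (hs i) \<cdot> n) \<otimes> gs i)"
    by (intro sum.cong refl) (simp only: un insert.prems(4))
  have "(u h \<cdot> n) \<otimes> g + (\<Sum>i\<in>insert k A. (u (hs i) \<cdot> n) \<otimes> gs i) \<in> I (W \<odot> U) (W \<odot> V)"
    using TensM_sandwich_mem[OF I Comp_in_Hom[OF n(1) a] b insert.prems(3,1) insert.prems(4,5,6)]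
      insert.prems(1) by (simp add: un eq)
  moreover have "u h \<cdot> n = n" using bha by (simp add: u_def Comp_Id_left[OF n(1)])
  ultimately have 1: "n \<otimes> g + ((u (hs k) \<cdot> n) \<otimes> gs k + ?S) \<in> I (W \<odot> U) (W \<odot> V)"
    using insert.hyps by simp
  have 2: "(u (hs k) \<cdot> n - scl C c n) \<otimes> gs k \<in> I (W \<odot> U) (W \<odot> V)"
    using eig by (intro tensor_ideal_TensM[OF I _ gk] Hom_diff unH[OF hk] Hom_scl n(1)) simp
  have "(u (hs k) \<cdot> n) \<otimes> gs k = (u (hs k) \<cdot> n - scl C c n) \<otimes> gs k + n \<otimes> scl C c (gs k)"
    using TensM_add_left[OF Hom_diff[OF unH[OF hk] Hom_scl[OF n(1)]] Hom_scl[OF n(1)] gk, of c c]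
    by (simp add: TensM_scl_left[OF n(1) gk] TensM_scl_right[OF n(1) gk])
  then have "n \<otimes> (g + scl C c (gs k)) + ?S
      = (n \<otimes> g + ((u (hs k) \<cdot> n) \<otimes> gs k + ?S)) - (u (hs k) \<cdot> n - scl C c n) \<otimes> gs k"
    by (simp add: TensM_add_right[OF n(1) insert.prems(3) Hom_scl[OF gk]])
  also have "\<dots> \<in> I (W \<odot> U) (W \<odot> V)" by (rule subspace_diff[OF sub 1 2])
  finally have "\<exists>d. (g + scl C c (gs k)) + (\<Sum>i\<in>A. scl C (d i) (gs i)) \<in> I U V"
    using insert.prems
    by (intro insert.IH[OF n]) (auto intro: Hom_add Hom_scl gk unH)
  then obtain d where "(g + scl C c (gs k)) + (\<Sum>i\<in>A. scl C (d i) (gs i)) \<in> I U V" ..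
  moreover have "(\<Sum>i\<in>A. scl C ((d(k := c)) i) (gs i)) = (\<Sum>i\<in>A. scl C (d i) (gs i))"
    using insert.hyps by (intro sum.cong) auto
  ultimately have "g + (\<Sum>i\<in>insert k A. scl C ((d(k := c)) i) (gs i)) \<in> I U V"
    using insert.hyps by (simp add: add.assoc)
  then show ?case by blast
qed

end

section \<open>Formal tensors and faithful primality\<close>

lemma lookup_free_scl: "Poly_Mapping.lookup (free_scl c t) x = c * Poly_Mapping.lookup t x"
  by (simp add: free_scl_def map.rep_eq when_def)

interpretation free: vector_space "free_scl :: 'k::field \<Rightarrow> ('x \<Rightarrow>\<^sub>0 'k) \<Rightarrow> ('x \<Rightarrow>\<^sub>0 'k)"
  by standard (auto intro!: poly_mapping_eqI simp: lookup_free_scl lookup_add algebra_simps)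

lemma free_scl_single: "free_scl c (Poly_Mapping.single x d) = Poly_Mapping.single x (c * d)"
  by (rule poly_mapping_eqI) (simp add: lookup_free_scl lookup_single when_def)

lemma poly_mapping_eq_sum_single:
  "t = (\<Sum>x\<in>Poly_Mapping.keys t. Poly_Mapping.single x (Poly_Mapping.lookup t x))"
  by (rule poly_mapping_eqI) (simp add: lookup_sum lookup_single when_def in_keys_iff)

lemma subspace_free_space: "free.subspace (free_space S :: ('x \<Rightarrow>\<^sub>0 'k::field) set)"
proof -
  have "t \<in> free_space S \<longleftrightarrow> (\<forall>x. x \<notin> S \<longrightarrow> Poly_Mapping.lookup t x = 0)" for t :: "'x \<Rightarrow>\<^sub>0 'k"
    by (auto simp: free_space_def in_keys_iff)
  then show ?thesis
    by (intro free.subspaceI) (auto simp: lookup_add lookup_free_scl)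
qed

lemma single_in_free_space: "x \<in> S \<Longrightarrow> Poly_Mapping.single x c \<in> free_space S"
  by (auto simp: free_space_def)

lemma free_space_mono: "S \<subseteq> T \<Longrightarrow> free_space S \<subseteq> free_space T"
  by (auto simp: free_space_def)

lemma tensor_rel_class_eq:
  assumes "t \<in> free_space (V \<times> W)" "t' \<in> free_space (V \<times> W)"
    and "t - t' \<in> free.span (bilinear_relators s V W)"
  shows "tensor_rel s V W `` {t} = tensor_rel s V W `` {t'}"
proof -
  have "t - x \<in> free.span (bilinear_relators s V W) \<longleftrightarrow> t' - x \<in> free.span (bilinear_relators s V W)" for x
    using free.span_diff[OF _ assms(3), of "t - x"] free.span_add[OF _ assms(3), of "t' - x"]
    by (auto simp: algebra_simps)
  then show ?thesis using assms(1,2) by (auto simp: tensor_rel_def)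
qed

context
  fixes s :: "'k::field \<Rightarrow> 'm::ab_group_add \<Rightarrow> 'm" and V W :: "'m set"
begin

abbreviation (input) elem_tensor :: "'m \<Rightarrow> 'm \<Rightarrow> 'm \<times> 'm \<Rightarrow>\<^sub>0 'k" where
  "elem_tensor f g \<equiv> Poly_Mapping.single (f, g) 1"

lemma bilinear_relators_add_left:
  "\<lbrakk>v \<in> V; v' \<in> V; w \<in> W\<rbrakk> \<Longrightarrow>
    elem_tensor (v + v') w - elem_tensor v w - elem_tensor v' w \<in> bilinear_relators s V W"
  unfolding bilinear_relators_def Let_def by blast

lemma bilinear_relators_add_right:
  "\<lbrakk>v \<in> V; w \<in> W; w' \<in> W\<rbrakk> \<Longrightarrow>
    elem_tensor v (w + w') - elem_tensor v w - elem_tensor v w' \<in> bilinear_relators s V W"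
  unfolding bilinear_relators_def Let_def by blast

lemma bilinear_relators_scale_left:
  "\<lbrakk>v \<in> V; w \<in> W\<rbrakk> \<Longrightarrow>
    elem_tensor (s c v) w - free_scl c (elem_tensor v w) \<in> bilinear_relators s V W"
  unfolding bilinear_relators_def Let_def by blast

lemma bilinear_relators_scale_right:
  "\<lbrakk>v \<in> V; w \<in> W\<rbrakk> \<Longrightarrow>
    elem_tensor v (s c w) - free_scl c (elem_tensor v w) \<in> bilinear_relators s V W"
  unfolding bilinear_relators_def Let_def by blast

end

context linear_monoidal_category
begin

lemma bilinear_relators_sum_right:
  assumes "subspace W" "finite A" "h \<in> V" "g \<in> W" "\<And>i. i \<in> A \<Longrightarrow> gs i \<in> W"
  shows "elem_tensor h (g + (\<Sum>i\<in>A. scl C (c i) (gs i))) - elem_tensor h g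
      - (\<Sum>i\<in>A. free_scl (c i) (elem_tensor h (gs i))) \<in> free.span (bilinear_relators (scl C) V W)"
  using assms(2,5)
proof (induction A rule: finite_induct)
  case empty
  show ?case by (simp add: free.span_zero)
next
  case (insert k A)
  let ?S = "free.span (bilinear_relators (scl C) V W)"
  let ?g = "g + (\<Sum>i\<in>A. scl C (c i) (gs i))"
  have gW: "?g \<in> W"
    using insert.prems by (intro subspace_add assms(1,4) subspace_sum subspace_scale) auto
  have kW: "gs k \<in> W" "scl C (c k) (gs k) \<in> W"
    using insert.prems by (auto intro: subspace_scale[OF assms(1)])
  have "elem_tensor h (?g + scl C (c k) (gs k)) - elem_tensor h ?g - elem_tensor h (scl C (c k) (gs k)) \<in> ?S"
    by (rule free.span_base[OF bilinear_relators_add_right[OF assms(3) gW kW(2)]])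
  moreover have "elem_tensor h (scl C (c k) (gs k)) - free_scl (c k) (elem_tensor h (gs k)) \<in> ?S"
    by (rule free.span_base[OF bilinear_relators_scale_right[OF assms(3) kW(1)]])
  moreover have "elem_tensor h ?g - elem_tensor h g
      - (\<Sum>i\<in>A. free_scl (c i) (elem_tensor h (gs i))) \<in> ?S"
    using insert.prems by (intro insert.IH) auto
  ultimately have "(elem_tensor h (?g + scl C (c k) (gs k)) - elem_tensor h ?g - elem_tensor h (scl C (c k) (gs k)))
      + (elem_tensor h (scl C (c k) (gs k)) - free_scl (c k) (elem_tensor h (gs k)))
      + (elem_tensor h ?g - elem_tensor h g - (\<Sum>i\<in>A. free_scl (c i) (elem_tensor h (gs i)))) \<in> ?S"
    by (intro free.span_add)
  moreover have "g + (\<Sum>i\<in>insert k A. scl C (c i) (gs i)) = ?g + scl C (c k) (gs k)"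
    using insert.hyps by (simp add: algebra_simps)
  ultimately show ?case using insert.hyps by (simp add: algebra_simps)
qed

lemma tensor_eval_superset:
  assumes "finite S" "Poly_Mapping.keys t \<subseteq> S"
  shows "tensor_eval C t = (\<Sum>(f, g)\<in>S. scl C (Poly_Mapping.lookup t (f, g)) (f \<otimes> g))"
  unfolding tensor_eval_def using assms by (intro sum.mono_neutral_left) (auto simp: in_keys_iff)

lemma tensor_eval_add: "tensor_eval C (t + t') = tensor_eval C t + tensor_eval C t'"
proof -
  let ?S = "Poly_Mapping.keys t \<union> Poly_Mapping.keys t'"
  have "Poly_Mapping.keys (t + t') \<subseteq> ?S" by (rule Poly_Mapping.keys_add)
  then show ?thesis
    by (simp add: tensor_eval_superset[of ?S] lookup_add scale_left_distrib sum.distrib case_prod_unfold)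
qed

lemma tensor_eval_scl: "tensor_eval C (free_scl c t) = scl C c (tensor_eval C t)"
proof -
  have "Poly_Mapping.keys (free_scl c t) \<subseteq> Poly_Mapping.keys t"
    by (auto simp: in_keys_iff lookup_free_scl)
  then show ?thesis
    by (simp add: tensor_eval_superset[of "Poly_Mapping.keys t"] lookup_free_scl scale_sum_right case_prod_unfold)
qed

lemma tensor_eval_diff: "tensor_eval C (t - t') = tensor_eval C t - tensor_eval C t'"
  using tensor_eval_add[of "t - t'" t'] by (simp add: algebra_simps)

lemma tensor_eval_elem_tensor: "tensor_eval C (elem_tensor f g) = f \<otimes> g"
  by (simp add: tensor_eval_def)

lemma tensor_eval_relators:
  assumes "t \<in> free.span (bilinear_relators (scl C) (Hom C X Y) (Hom C U V))"
  shows "tensor_eval C t = 0"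
proof -
  have "free.subspace {t. tensor_eval C t = 0}"
    using tensor_eval_diff[of 0 0] by (intro free.subspaceI) (auto simp: tensor_eval_add tensor_eval_scl)
  moreover have "bilinear_relators (scl C) (Hom C X Y) (Hom C U V) \<subseteq> {t. tensor_eval C t = 0}"
    unfolding bilinear_relators_def Let_def
    by (auto simp: tensor_eval_diff tensor_eval_scl tensor_eval_elem_tensor
        TensM_add_left TensM_add_right TensM_scl_left TensM_scl_right)
  ultimately show ?thesis using assms free.span_minimal by blast
qed

lemma tensor_map_class:
  assumes "t \<in> free_space (Hom C X Y \<times> Hom C U V)"
  shows "tensor_map C (tensor_rel (scl C) (Hom C X Y) (Hom C U V) `` {t}) = tensor_eval C t"
proof -
  let ?T = "tensor_rel (scl C) (Hom C X Y) (Hom C U V) `` {t}"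
  have "tensor_eval C x = tensor_eval C t" if "x \<in> ?T" for x
    using that tensor_eval_relators[of "t - x" X Y U V] by (auto simp: tensor_rel_def tensor_eval_diff)
  moreover have "t \<in> ?T" using assms by (auto simp: tensor_rel_def free.span_zero)
  ultimately have "tensor_eval C ` ?T = {tensor_eval C t}" by blast
  then show ?thesis by (simp add: tensor_map_def)
qed

lemma tensor_eval_mem:
  assumes I: "tensor_ideal C I" and t: "t \<in> free_space (S \<times> T)"
    and sub: "S \<subseteq> Hom C X Y" "T \<subseteq> Hom C U V" and mem: "S \<subseteq> I X Y \<or> T \<subseteq> I U V"
  shows "tensor_eval C t \<in> I (X \<odot> U) (Y \<odot> V)"
proof -
  have "f \<otimes> g \<in> I (X \<odot> U) (Y \<odot> V)" if "(f, g) \<in> Poly_Mapping.keys t" for f g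
  proof -
    have "f \<in> S" "g \<in> T" using t that by (auto simp: free_space_def)
    then show ?thesis using sub mem by (intro tensor_ideal_TensM[OF I]) auto
  qed
  then show ?thesis unfolding tensor_eval_def
    by (auto intro!: subspace_sum subspace_scale tensor_ideal_subspace[OF I])
qed

end

context pseudo_tensor_category_with_commutor
begin

text \<open>
  The span in the conclusion is the preimage, among formal tensors, of
  \<open>I(X,Y) \<otimes> Hom(U,V) + Hom(X,Y) \<otimes> I(U,V)\<close>. A summand with \<open>hs j\<close> in \<open>I\<close> can be dropped; otherwise
  \<open>gs j\<close> is modulo \<open>I\<close> a combination of the others, and bilinearity distributes the summand over them.
\<close>

lemma tensor_kernel_of_sum:
  assumes closed: "\<And>p :: 'k poly. degree p > 0 \<Longrightarrow> \<exists>x. poly p x = 0"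
    and prime: "prime_tensor_ideal C I" and max: "largest_ideal (Ob C I) = I"
    and "finite A"
    and "\<And>i. i \<in> A \<Longrightarrow> hs i \<in> Hom C X Y" "\<And>i. i \<in> A \<Longrightarrow> gs i \<in> Hom C U V"
    and "(\<Sum>i\<in>A. hs i \<otimes> gs i) \<in> I (X \<odot> U) (Y \<odot> V)"
  shows "(\<Sum>i\<in>A. elem_tensor (hs i) (gs i)) \<in>
    free.span (bilinear_relators (scl C) (Hom C X Y) (Hom C U V)
      \<union> ((\<lambda>(f, g). elem_tensor f g) ` (I X Y \<times> Hom C U V)
        \<union> (\<lambda>(f, g). elem_tensor f g) ` (Hom C X Y \<times> I U V)))"
    (is "_ \<in> ?S")
  using assms(4-)
proof (induction A arbitrary: hs rule: finite_induct)
  case empty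
  show ?case by (simp add: free.span_zero)
next
  case (insert j A)
  let ?R = "bilinear_relators (scl C) (Hom C X Y) (Hom C U V)"
  have I: "tensor_ideal C I" using prime by (simp add: prime_tensor_ideal_def)
  note sub = tensor_ideal_subspace[OF I]
  have R: "x \<in> ?S" if "x \<in> free.span ?R" for x
    using that free.span_mono[of ?R "?R \<union> _"] by blast
  have S1: "elem_tensor f g \<in> ?S" if "f \<in> I X Y" "g \<in> Hom C U V" for f g
    using that by (intro free.span_base) auto
  have S2: "elem_tensor f g \<in> ?S" if "f \<in> Hom C X Y" "g \<in> I U V" for f g
    using that by (intro free.span_base) auto
  have hj: "hs j \<in> Hom C X Y" and gj: "gs j \<in> Hom C U V"
    and hA: "\<And>i. i \<in> A \<Longrightarrow> hs i \<in> Hom C X Y" and gA: "\<And>i. i \<in> A \<Longrightarrow> gs i \<in> Hom C U V"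
    using insert.prems by auto
  have total: "hs j \<otimes> gs j + (\<Sum>i\<in>A. hs i \<otimes> gs i) \<in> I (X \<odot> U) (Y \<odot> V)"
    using insert.prems(3) insert.hyps by simp
  have "elem_tensor (hs j) (gs j) + (\<Sum>i\<in>A. elem_tensor (hs i) (gs i)) \<in> ?S"
  proof (cases "hs j \<in> I X Y")
    case True
    have "hs j \<otimes> gs j \<in> I (X \<odot> U) (Y \<odot> V)"
      using True by (intro tensor_ideal_TensM[OF I hj gj]) simp
    from subspace_diff[OF sub total this]
    have "(\<Sum>i\<in>A. hs i \<otimes> gs i) \<in> I (X \<odot> U) (Y \<odot> V)" by simp
    with hA gA have "(\<Sum>i\<in>A. elem_tensor (hs i) (gs i)) \<in> ?S" by (rule insert.IH)
    with S1[OF True gj] show ?thesis by (rule free.span_add)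
  next
    case False
    from dependence_mod_prime_tensor_ideal[OF closed prime max insert.hyps(1) hj False gj hA gA total]
    obtain c where c: "gs j + (\<Sum>i\<in>A. scl C (c i) (gs i)) \<in> I U V" (is "?g \<in> _") by blast
    define hs' where "hs' i = hs i - scl C (c i) (hs j)" for i
    have h'A: "hs' i \<in> Hom C X Y" if "i \<in> A" for i
      unfolding hs'_def by (intro Hom_diff Hom_scl hA hj that)
    have hs: "hs i = hs' i + scl C (c i) (hs j)" for i by (simp add: hs'_def)
    have "hs i \<otimes> gs i = hs' i \<otimes> gs i + hs j \<otimes> scl C (c i) (gs i)" if "i \<in> A" for i
      unfolding hs[of i] TensM_add_left[OF h'A[OF that] Hom_scl[OF hj] gA[OF that]]
      by (simp add: TensM_scl_left[OF hj gA[OF that]] TensM_scl_right[OF hj gA[OF that]])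
    then have "(\<Sum>i\<in>A. hs i \<otimes> gs i)
        = (\<Sum>i\<in>A. hs' i \<otimes> gs i) + (\<Sum>i\<in>A. hs j \<otimes> scl C (c i) (gs i))"
      by (simp add: sum.distrib)
    moreover have "(\<Sum>i\<in>A. hs j \<otimes> scl C (c i) (gs i)) = hs j \<otimes> (\<Sum>i\<in>A. scl C (c i) (gs i))"
      by (rule TensM_sum_right[symmetric, of A _ U V, OF _ hj]) (intro Hom_scl gA)
    moreover have sumH: "(\<Sum>i\<in>A. scl C (c i) (gs i)) \<in> Hom C U V"
      by (intro Hom_sum Hom_scl gA)
    ultimately have "(\<Sum>i\<in>A. hs' i \<otimes> gs i)
        = (hs j \<otimes> gs j + (\<Sum>i\<in>A. hs i \<otimes> gs i)) - hs j \<otimes> ?g"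
      by (simp add: TensM_add_right[OF hj gj sumH])
    also have "\<dots> \<in> I (X \<odot> U) (Y \<odot> V)"
      using c by (intro subspace_diff[OF sub total] tensor_ideal_TensM[OF I hj]
          tensor_ideal_in_Hom[OF I c]) simp
    finally have IH: "(\<Sum>i\<in>A. elem_tensor (hs' i) (gs i)) \<in> ?S"
      by (intro insert.IH h'A gA)
    have "elem_tensor (hs i) (gs i) - elem_tensor (hs' i) (gs i)
        - free_scl (c i) (elem_tensor (hs j) (gs i)) \<in> free.span ?R" if i: "i \<in> A" for i
    proof -
      have "(elem_tensor (hs i) (gs i) - elem_tensor (hs' i) (gs i) - elem_tensor (scl C (c i) (hs j)) (gs i))
        + (elem_tensor (scl C (c i) (hs j)) (gs i) - free_scl (c i) (elem_tensor (hs j) (gs i))) \<in> free.span ?R"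
        using bilinear_relators_add_left[OF h'A[OF i] Hom_scl[OF hj, of "c i"] gA[OF i], where s = "scl C"]
          bilinear_relators_scale_left[OF hj gA[OF i], where s = "scl C" and c = "c i"]
        unfolding hs[of i, symmetric] by (intro free.span_add free.span_base)
      then show ?thesis by simp
    qed
    then have "(\<Sum>i\<in>A. elem_tensor (hs i) (gs i) - elem_tensor (hs' i) (gs i)
        - free_scl (c i) (elem_tensor (hs j) (gs i))) \<in> free.span ?R"
      by (rule free.span_sum)
    then have D: "(\<Sum>i\<in>A. elem_tensor (hs i) (gs i)) - (\<Sum>i\<in>A. elem_tensor (hs' i) (gs i))
        - (\<Sum>i\<in>A. free_scl (c i) (elem_tensor (hs j) (gs i))) \<in> ?S" (is "?D \<in> _")
      unfolding sum_subtractf by (rule R)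
    have E: "elem_tensor (hs j) ?g - elem_tensor (hs j) (gs j)
        - (\<Sum>i\<in>A. free_scl (c i) (elem_tensor (hs j) (gs i))) \<in> ?S" (is "?E \<in> _")
      by (rule R, rule bilinear_relators_sum_right[OF subspace_Hom insert.hyps(1) hj gj gA])
    have "?D + (\<Sum>i\<in>A. elem_tensor (hs' i) (gs i)) + (elem_tensor (hs j) ?g - ?E) \<in> ?S"
      by (intro free.span_add free.span_diff D E IH S2 hj c)
    then show ?thesis by (simp add: algebra_simps)
  qed
  then show ?case using insert.hyps by simp
qed

lemma prime_tensor_ideal_faithfully_prime:
  assumes closed: "\<And>p :: 'k poly. degree p > 0 \<Longrightarrow> \<exists>x. poly p x = 0"
    and prime: "prime_tensor_ideal C I" and max: "largest_ideal (Ob C I) = I"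
  shows "faithfully_prime C I"
  unfolding faithfully_prime_def
proof (intro conjI allI equalityI subsetI)
  show I: "tensor_ideal C I" and "I \<noteq> Hom C" using prime by (simp_all add: prime_tensor_ideal_def)
  fix X Y U V T
  let ?V = "Hom C X Y" and ?W = "Hom C U V"
  let ?rel = "tensor_rel (scl C) ?V ?W" and ?R = "bilinear_relators (scl C) ?V ?W"
  have sub: "I X Y \<subseteq> ?V" "I U V \<subseteq> ?W" using tensor_ideal_in_Hom[OF I] by blast+
  then have fsub: "free_space (I X Y \<times> ?W) \<subseteq> free_space (?V \<times> ?W)"
    "free_space (?V \<times> I U V) \<subseteq> free_space (?V \<times> ?W)"
    by (intro free_space_mono; blast)+
  {
    assume "T \<in> {T \<in> tensor_space (scl C) ?V ?W. tensor_map C T \<in> I (X \<odot> U) (Y \<odot> V)}"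
    then obtain t where t: "t \<in> free_space (?V \<times> ?W)" "T = ?rel `` {t}"
      and mem: "tensor_eval C t \<in> I (X \<odot> U) (Y \<odot> V)"
      by (auto simp: tensor_space_def tensor_map_class elim!: quotientE)
    let ?E1 = "(\<lambda>(f, g). elem_tensor f g) ` (I X Y \<times> ?W)"
      and ?E2 = "(\<lambda>(f, g). elem_tensor f g) ` (?V \<times> I U V)"
    let ?S = "free.span (?R \<union> (?E1 \<union> ?E2))"
    let ?K = "Poly_Mapping.keys t" and ?c = "Poly_Mapping.lookup t"
    have K: "fst p \<in> ?V" "snd p \<in> ?W" if "p \<in> ?K" for p
      using t(1) that by (auto simp: free_space_def)
    have "(\<Sum>p\<in>?K. scl C (?c p) (fst p) \<otimes> snd p) = tensor_eval C t"
      unfolding tensor_eval_def case_prod_unfold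
      by (intro sum.cong) (simp_all add: TensM_scl_left[OF K])
    then have 1: "(\<Sum>p\<in>?K. elem_tensor (scl C (?c p) (fst p)) (snd p)) \<in> ?S"
      using mem K by (intro tensor_kernel_of_sum[OF closed prime max]) (auto intro: Hom_scl)
    have "elem_tensor (scl C (?c p) (fst p)) (snd p) - free_scl (?c p) (elem_tensor (fst p) (snd p)) \<in> ?S"
      if "p \<in> ?K" for p
      using bilinear_relators_scale_left[OF K[OF that], where s = "scl C" and c = "?c p"] by (intro free.span_base) simp
    then have 2: "(\<Sum>p\<in>?K. elem_tensor (scl C (?c p) (fst p)) (snd p)
        - free_scl (?c p) (elem_tensor (fst p) (snd p))) \<in> ?S"
      by (rule free.span_sum)
    have "t = (\<Sum>p\<in>?K. free_scl (?c p) (elem_tensor (fst p) (snd p)))"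
      using poly_mapping_eq_sum_single[of t] by (simp add: free_scl_single)
    then have "t \<in> ?S" using free.span_diff[OF 1 2] by (simp add: sum_subtractf)
    then obtain x t1 t2 where x: "x \<in> free.span ?R" and t12: "t1 \<in> free.span ?E1" "t2 \<in> free.span ?E2"
      and eq: "t = x + (t1 + t2)"
      unfolding free.span_Un by auto
    have "free.span ?E1 \<subseteq> free_space (I X Y \<times> ?W)" "free.span ?E2 \<subseteq> free_space (?V \<times> I U V)"
      by (intro free.span_minimal subspace_free_space; auto intro: single_in_free_space)+
    with t12 have t12: "t1 \<in> free_space (I X Y \<times> ?W)" "t2 \<in> free_space (?V \<times> I U V)" by auto
    then have "t1 + t2 \<in> free_space (?V \<times> ?W)"
      using fsub by (intro free.subspace_add[OF subspace_free_space]) auto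
    with t(1) have "?rel `` {t} = ?rel `` {t1 + t2}"
      using x eq by (intro tensor_rel_class_eq) simp_all
    with t(2) t12 show "T \<in> tensor_subspace_sum (scl C) (I X Y) ?V (I U V) ?W"
      unfolding tensor_subspace_sum_def by blast
  }
  assume "T \<in> tensor_subspace_sum (scl C) (I X Y) ?V (I U V) ?W"
  then obtain t1 t2 where t: "t1 \<in> free_space (I X Y \<times> ?W)" "t2 \<in> free_space (?V \<times> I U V)"
    and T: "T = ?rel `` {t1 + t2}"
    unfolding tensor_subspace_sum_def by blast
  have t12: "t1 + t2 \<in> free_space (?V \<times> ?W)"
    using t fsub by (intro free.subspace_add[OF subspace_free_space]) auto
  have "tensor_eval C t1 \<in> I (X \<odot> U) (Y \<odot> V)" "tensor_eval C t2 \<in> I (X \<odot> U) (Y \<odot> V)"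
    using tensor_eval_mem[OF I t(1) sub(1) order_refl] tensor_eval_mem[OF I t(2) order_refl sub(2)]
    by auto
  then have "tensor_map C T \<in> I (X \<odot> U) (Y \<odot> V)"
    unfolding T tensor_map_class[OF t12] tensor_eval_add
    by (rule subspace_add[OF tensor_ideal_subspace[OF I]])
  moreover have "T \<in> tensor_space (scl C) ?V ?W"
    unfolding T tensor_space_def by (rule quotientI[OF t12])
  ultimately show "T \<in> {T \<in> tensor_space (scl C) ?V ?W. tensor_map C T \<in> I (X \<odot> U) (Y \<odot> V)}"
    by blast
qed

end

section \<open>The correspondence between prime tensor ideals and prime thick tensor ideals\<close>

theorem theorem2p3p2:
  fixes C :: "('k::field, 'o, 'm::ab_group_add) mon_cat"
    and \<gamma> :: "'o \<Rightarrow> 'o \<Rightarrow> 'm"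
    and M :: nat
  assumes "pseudo_tensor_category C"
    and "commutor C \<gamma>"
    and "\<And>X Y. radical_power C M X Y = {0}"
  shows "bij_betw (Ob C) {I. prime_tensor_ideal C I} {J. prime_thick_tensor_ideal C J}
       \<and> bij_betw (max_ideal C) {J. prime_thick_tensor_ideal C J} {I. prime_tensor_ideal C I}
       \<and> (\<forall>I. prime_tensor_ideal C I \<longrightarrow> max_ideal C (Ob C I) = I)
       \<and> (\<forall>J. prime_thick_tensor_ideal C J \<longrightarrow> Ob C (max_ideal C J) = J)
       \<and> (\<forall>I. tensor_ideal C I \<longrightarrow>
            (prime_tensor_ideal C I \<longleftrightarrow> semiprimitive C I \<and> prime_thick_tensor_ideal C (Ob C I)))
       \<and> ((\<forall>p :: 'k poly. degree p > 0 \<longrightarrow> (\<exists>x. poly p x = 0)) \<longrightarrow>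
            (\<forall>I. prime_tensor_ideal C I \<longrightarrow> faithfully_prime C I))"
proof -
  interpret pseudo_tensor_category_with_commutor C \<gamma>
    using assms(1,2)
    by (simp add: pseudo_tensor_category_with_commutor_def pseudo_tensor_category_with_commutor_axioms_def)
  have thick: "thick_tensor_ideal C J" if "prime_thick_tensor_ideal C J" for J
    using that by (simp add: prime_thick_tensor_ideal_def)
  have Ob_prime: "prime_thick_tensor_ideal C (Ob C I)" if "prime_tensor_ideal C I" for I
    using that by (rule prime_thick_tensor_ideal_Ob)
  have largest_Ob: "largest_ideal (Ob C I) = I" if "prime_tensor_ideal C I" for I
    using assms(3) that by (rule prime_tensor_ideal_eq_largest_ideal)
  have max_Ob: "max_ideal C (Ob C I) = I" if "prime_tensor_ideal C I" for I
    using max_ideal_eq_largest_ideal[OF thick[OF Ob_prime[OF that]]] largest_Ob[OF that] by simp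
  have Ob_max: "Ob C (max_ideal C J) = J" if "thick_tensor_ideal C J" for J
    using max_ideal_eq_largest_ideal[OF that] Ob_largest_ideal[OF that] by simp
  have max_prime: "prime_tensor_ideal C (max_ideal C J)" if "prime_thick_tensor_ideal C J" for J
    using max_ideal_eq_largest_ideal[OF thick[OF that]] prime_largest_ideal[OF that] by simp
  have "bij_betw (Ob C) {I. prime_tensor_ideal C I} {J. prime_thick_tensor_ideal C J}"
    by (rule bij_betw_byWitness[where f' = "max_ideal C"])
      (auto simp: max_Ob Ob_max thick Ob_prime max_prime)
  moreover have "bij_betw (max_ideal C) {J. prime_thick_tensor_ideal C J} {I. prime_tensor_ideal C I}"
    by (rule bij_betw_byWitness[where f' = "Ob C"])
      (auto simp: max_Ob Ob_max thick Ob_prime max_prime)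
  moreover have "prime_tensor_ideal C I \<longleftrightarrow> semiprimitive C I \<and> prime_thick_tensor_ideal C (Ob C I)" for I
    unfolding semiprimitive_def using max_Ob Ob_max thick Ob_prime max_prime by metis
  moreover have "faithfully_prime C I"
    if "\<forall>p :: 'k poly. degree p > 0 \<longrightarrow> (\<exists>x. poly p x = 0)" "prime_tensor_ideal C I" for I
    using that(1) by (intro prime_tensor_ideal_faithfully_prime that(2) largest_Ob) blast
  ultimately show ?thesis using max_Ob Ob_max thick by blast
qed

end
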